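(* Let $d\ge3$, $\theta\in(0,\pi/2)$, $\lambda\in\Sigma_\theta$ and $x\ne0$ with $|\lambda||x|^2\le 1/2$. Then $$|\nabla_x\{\Gamma(x;\lambda)-\Gamma(x;0)\}|\le\begin{cases}C|\lambda||x|^{3-d}, & d=5 \text{ or } d\ge7,\\ C|\lambda||x|^{3-d}\,|\log(|\lambda||x|^2)|, & d=4\text{ or }6,\\ C\sqrt{|\lambda|}\,|x|^{-1}, & d=3,\end{cases}$$ where $C$ depends only on $d$ and $\theta$.
   Context: $\Sigma_\theta=\{z\in\mathbb{C}: z\neq0,\ |\arg z|<\pi-\theta\}$. For $\lambda=re^{i\tau}\in\Sigma_\theta$, $k=\sqrt r\,e^{i(\pi+\tau)/2}$; $G(x;\lambda)=\frac{i}{4(2\pi)^{(d-2)/2}}|x|^{2-d}(k|x|)^{\frac d2-1}H^{(1)}_{\frac d2-1}(k|x|)$ ($H^{(1)}_\nu$ the Hankel function of the first kind); $G(x;0)=\frac{1}{(d-2)\omega_d}|x|^{2-d}$, $\omega_d=|\mathbb{S}^{d-1}|$. $\Gamma_{\alpha\beta}(x;\lambda)=G(x;\lambda)\delta_{\alpha\beta}-\frac1\lambda\partial_\alpha\partial_\beta\{G(x;\lambda)-G(x;0)\}$, and $\Gamma(x;0)$ is the Stokes fundamental matrix for $\lambda=0$: $$\Gamma_{\alpha\beta}(x;0)=\frac{1}{2\omega_d}\Big\{\frac{\delta_{\alpha\beta}}{(d-2)|x|^{d-2}}+\frac{x_\alpha x_\beta}{|x|^d}\Big\}.$$ *)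

theory Defs
  imports "HOL-Analysis.Analysis"
begin

definition Sigma :: "real \<Rightarrow> complex set" where
  "Sigma \<theta> = {z. z \<noteq> 0 \<and> \<bar>Arg z\<bar> < pi - \<theta>}"

definition besselJ :: "real \<Rightarrow> complex \<Rightarrow> complex" where
  "besselJ \<nu> z = (z / 2) powr (complex_of_real \<nu>) *
     (\<Sum>m. (-1) ^ m * rGamma (of_nat m + complex_of_real \<nu> + 1) / of_nat (fact m) * (z / 2) ^ (2 * m))"

definition besselY_aux :: "real \<Rightarrow> complex \<Rightarrow> complex" where
  "besselY_aux \<mu> z = (besselJ \<mu> z * cos (of_real (\<mu> * pi)) - besselJ (- \<mu>) z) / sin (of_real (\<mu> * pi))"

definition besselY :: "real \<Rightarrow> complex \<Rightarrow> complex" where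
  "besselY \<nu> z = (if \<nu> \<in> \<int> then Lim (at \<nu>) (\<lambda>\<mu>. besselY_aux \<mu> z) else besselY_aux \<nu> z)"

definition hankel1 :: "real \<Rightarrow> complex \<Rightarrow> complex" where
  "hankel1 \<nu> z = besselJ \<nu> z + \<i> * besselY \<nu> z"

text \<open>omega_d = surface measure of S^(d-1) = 2 pi^(d/2) / Gamma(d/2).\<close>
definition omega :: "nat \<Rightarrow> real" where
  "omega d = 2 * pi powr (real d / 2) / Gamma (real d / 2)"

definition kk :: "complex \<Rightarrow> complex" where
  "kk lam = complex_of_real (sqrt (cmod lam)) * exp (\<i> * complex_of_real ((pi + Arg lam) / 2))"

definition G :: "('n::finite) itself \<Rightarrow> real ^ 'n \<Rightarrow> complex \<Rightarrow> complex" where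
  "G _ x lam = (let d = real CARD('n) in
     \<i> / (4 * of_real ((2 * pi) powr ((d - 2) / 2))) * of_real (norm x powr (2 - d))
       * (kk lam * of_real (norm x)) powr (of_real (d / 2 - 1))
       * hankel1 (d / 2 - 1) (kk lam * of_real (norm x)))"

definition G0 :: "('n::finite) itself \<Rightarrow> real ^ 'n \<Rightarrow> complex" where
  "G0 _ x = (let d = CARD('n) in
     complex_of_real (1 / ((real d - 2) * omega d) * norm x powr (2 - real d)))"

definition pd :: "(real ^ 'n \<Rightarrow> complex) \<Rightarrow> 'n \<Rightarrow> real ^ 'n \<Rightarrow> complex" where
  "pd f \<alpha> x = vector_derivative (\<lambda>t. f (x + t *\<^sub>R axis \<alpha> 1)) (at 0)"

definition Gamma_res :: "complex \<Rightarrow> real ^ ('n::finite) \<Rightarrow> 'n \<Rightarrow> 'n \<Rightarrow> complex" where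
  "Gamma_res lam x \<alpha> \<beta> = G TYPE('n) x lam * (if \<alpha> = \<beta> then 1 else 0)
     - (1 / lam) * pd (pd (\<lambda>y. G TYPE('n) y lam - G0 TYPE('n) y) \<beta>) \<alpha> x"

definition Gamma_stokes :: "real ^ ('n::finite) \<Rightarrow> 'n \<Rightarrow> 'n \<Rightarrow> complex" where
  "Gamma_stokes x \<alpha> \<beta> = complex_of_real (1 / (2 * omega CARD('n)) *
     ((if \<alpha> = \<beta> then 1 else 0) / ((real CARD('n) - 2) * norm x ^ (CARD('n) - 2))
      + x $ \<alpha> * x $ \<beta> / norm x ^ CARD('n)))"

definition grad_diff_norm :: "complex \<Rightarrow> real ^ ('n::finite) \<Rightarrow> real" where
  "grad_diff_norm lam x = sqrt (\<Sum>\<alpha>\<in>UNIV. \<Sum>\<beta>\<in>UNIV. \<Sum>\<gamma>\<in>UNIV.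
      (cmod (pd (\<lambda>y. Gamma_res lam y \<alpha> \<beta> - Gamma_stokes y \<alpha> \<beta>) \<gamma> x))\<^sup>2)"

end

theory Submission
  imports Defs "HOL-Complex_Analysis.Complex_Analysis"
begin

text \<open>
  Put \<open>\<nu> = d/2 - 1\<close>, \<open>\<rho> = |x|\<^sup>2\<close> and let \<open>U\<^sub>\<nu>(\<rho>) = r\<^sup>-\<^sup>\<nu> k\<^sup>\<nu> H\<^sub>\<nu>(k r)\<close> with \<open>r = |x|\<close>, so that \<open>G\<close> is a constant
  multiple of \<open>U\<^sub>\<nu>\<close>. Since \<open>dU\<^sub>\<nu>/d\<rho> = - U\<^sub>\<nu>\<^sub>+\<^sub>1 / 2\<close>, every derivative of \<open>G\<close> raises the order, and the
  third derivatives only involve the orders \<open>\<nu> + 2, \<nu> + 3 \<ge> 5/2\<close>. There the two-term expansion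
  of \<open>U\<close> at the origin has an error of relative size \<open>(|\<lambda>|\<rho>)\<^sup>2\<close>, without logarithms; its first
  term comes from \<open>G(x;0)\<close> and the second one cancels against the Stokes matrix. Hence the gradient is
  \<open>O(|\<lambda>| |x|\<^sup>3\<^sup>-\<^sup>d)\<close> in every dimension \<open>d \<ge> 3\<close>, which implies all three cases.
\<close>

subsection \<open>The Bessel series and its derivative in the order\<close>

text \<open>Write t = |\<open>lam\<close>| \<rho>. The obstacle is the Hankel function at integer
  order, that is, in even dimension: there the function of the second kind is a limit in the order,
  so the Bessel series must be differentiated in the order as well as in its argument. At
  half-integer order, in odd dimension, it is up to sign the Bessel function of opposite order and
  no limit occurs. In both cases the profile becomes an explicit combination of entire series, after
  which the two parities are treated alike. The threshold 5/2 is where the regular solution stops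
  interfering with the expansion of the singular one. Relative to the leading term \<rho>^(-\<nu>)
  it has size t^\<nu>, times a logarithm at integer order. Absorbing the logarithm costs half a
  power, and t^(\<nu> - 1/2) is at most t^2 once \<nu> is at least 5/2. A profile of order \<nu> + 1
  also occurs, from the term G \<delta>, but without the factor 1/\<open>lam\<close>; a one-term
  expansion with relative error t suffices for it.\<close>

definition bcoef :: "nat \<Rightarrow> complex \<Rightarrow> complex" where
  "bcoef m s = (-1) ^ m * rGamma (of_nat m + s + 1) / fact m"

definition bcoef' :: "nat \<Rightarrow> complex \<Rightarrow> complex" where
  "bcoef' m s = (-1) ^ m * deriv rGamma (of_nat m + s + 1) / fact m"

text \<open>With w = (z/2)^2 this is (z/2)^(-s) J_s(z). Since \<open>rGamma\<close> is entire it is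
  entire in the order s too, including negative integer orders, and the branch of the power is kept
  out of the series.\<close>

definition bser :: "complex \<Rightarrow> complex \<Rightarrow> complex" where
  "bser s w = (\<Sum>m. bcoef m s * w ^ m)"

definition bser' :: "complex \<Rightarrow> complex \<Rightarrow> complex" where
  "bser' s w = (\<Sum>m. bcoef' m s * w ^ m)"

lemma deriv_rGamma: "(rGamma has_field_derivative deriv rGamma z) (at (z::complex))"
  using field_differentiable_rGamma DERIV_deriv_iff_field_differentiable by blast

lemma bcoef_deriv: "((\<lambda>s. bcoef m s) has_field_derivative bcoef' m s) (at s)"
proof -
  have "((\<lambda>s. rGamma (s + (of_nat m + 1))) has_field_derivative deriv rGamma (s + (of_nat m + 1))) (at s)"
    using deriv_rGamma by (subst DERIV_shift[symmetric])
  then have "((\<lambda>s. (-1) ^ m * rGamma (s + (of_nat m + 1)) / fact m) has_field_derivative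
      (-1) ^ m * deriv rGamma (s + (of_nat m + 1)) / fact m) (at s)"
    by (intro DERIV_cmult DERIV_cdivide)
  then show ?thesis by (simp add: bcoef_def bcoef'_def add_ac)
qed

text \<open>In rGamma(z + n) = (z + n) rGamma(z + n + 1) the factor z + n has modulus at least 1, so
  each unit shift can only decrease the modulus.\<close>

lemma norm_rGamma_shift_le:
  fixes z :: complex
  assumes "Re z \<ge> 1"
  shows "cmod (rGamma (z + of_nat n)) \<le> cmod (rGamma z)"
proof (induction n)
  case (Suc n)
  have "Re (z + of_nat n) \<ge> 1" using assms by simp
  then have 1: "cmod (z + of_nat n) \<ge> 1"
    by (meson complex_Re_le_cmod order_trans)
  have "(z + of_nat n) * rGamma (z + of_nat n + 1) = rGamma (z + of_nat n)"
    by (rule rGamma_plus1)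
  then have "cmod (z + of_nat n) * cmod (rGamma (z + of_nat (Suc n))) = cmod (rGamma (z + of_nat n))"
    by (metis norm_mult add.assoc add.commute of_nat_Suc)
  then have "cmod (rGamma (z + of_nat (Suc n))) \<le> cmod (rGamma (z + of_nat n))"
    using 1 by (metis mult_le_cancel_right1 norm_ge_zero not_le)
  then show ?case using Suc by linarith
qed simp

text \<open>Uniformity in m is the point: compactness bounds the finitely many small shifts, and
  beyond them the modulus no longer grows. This supplies the majorant for differentiating the series
  in the order.\<close>

lemma rGamma_shift_bounded:
  "\<exists>M. \<forall>m. \<forall>s\<in>cball s0 1. cmod (rGamma (of_nat m + s + 1)) \<le> M"
proof -
  \<comment> \<open>Large enough that m0 + s + 1 has real part at least 1 for every s in the unit
    disc around s0.\<close>
  define m0 where "m0 = nat \<lceil>cmod s0\<rceil> + 1"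
  have "\<exists>B. \<forall>s\<in>cball s0 1. cmod (rGamma (of_nat m + s + 1)) \<le> B" for m
  proof -
    have "continuous_on (cball s0 1) (\<lambda>s. rGamma (of_nat m + s + 1))"
      by (intro continuous_on_compose2[OF continuous_on_rGamma[of UNIV]] continuous_intros) auto
    then have "bounded ((\<lambda>s. rGamma (of_nat m + s + 1)) ` cball s0 1)"
      by (intro compact_imp_bounded compact_continuous_image) auto
    then show ?thesis by (auto simp: bounded_iff)
  qed
  then obtain B where B: "\<And>m s. s \<in> cball s0 1 \<Longrightarrow> cmod (rGamma (of_nat m + s + 1)) \<le> B m"
    by metis
  have B0: "B m \<ge> 0" for m using order_trans[OF norm_ge_zero B[of s0 m]] by simp
  have "cmod (rGamma (of_nat m + s + 1)) \<le> (\<Sum>j\<le>m0. B j)" if s: "s \<in> cball s0 1" for m s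
  proof (cases "m \<le> m0")
    case True
    then have "B m \<le> (\<Sum>j\<le>m0. B j)" using B0 by (intro member_le_sum) auto
    with B[OF s, of m] show ?thesis by linarith
  next
    case False
    have "\<bar>Re (s - s0)\<bar> \<le> 1" using s abs_Re_le_cmod[of "s - s0"] by (simp add: dist_norm norm_minus_commute)
    moreover have "\<bar>Re s0\<bar> \<le> cmod s0" by (rule abs_Re_le_cmod)
    moreover have "real m0 \<ge> cmod s0 + 1" unfolding m0_def by linarith
    ultimately have "Re (of_nat m0 + s + 1) \<ge> 1" by simp
    from norm_rGamma_shift_le[OF this, of "m - m0"] False
    have "cmod (rGamma (of_nat m + s + 1)) \<le> cmod (rGamma (of_nat m0 + s + 1))"
      by (simp add: algebra_simps of_nat_diff)
    also have "\<dots> \<le> B m0" using B[OF s] .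
    also have "B m0 \<le> (\<Sum>j\<le>m0. B j)" using B0 by (intro member_le_sum) auto
    finally show ?thesis .
  qed
  then show ?thesis by blast
qed

text \<open>A Weierstrass majorant M |w|^m / m!, valid on a disc of orders, is enough for
  holomorphic terms: convergence of the derived series follows without any estimate of
  \<open>bcoef'\<close>.\<close>

lemma
  shows bser_sums: "(\<lambda>m. bcoef m s * w ^ m) sums bser s w"
    and bser'_sums: "(\<lambda>m. bcoef' m s * w ^ m) sums bser' s w"
    and bser_deriv_order: "((\<lambda>s. bser s w) has_field_derivative bser' s w) (at s)"
proof -
  obtain M where M: "\<And>m t. t \<in> cball s 1 \<Longrightarrow> cmod (rGamma (of_nat m + t + 1)) \<le> M"
    using rGamma_shift_bounded by blast
  have sm: "summable (\<lambda>m. M * (cmod w ^ m / fact m))"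
    by (intro summable_mult) (use summable_exp_generic[of "cmod w"] in \<open>simp add: divide_inverse mult.commute\<close>)
  have le: "cmod (bcoef m t * w ^ m) \<le> M * (cmod w ^ m / fact m)" if "t \<in> ball s 1" for m t
    using mult_right_mono[OF M[of t m], of "cmod w ^ m / fact m"] that
    by (simp add: bcoef_def norm_mult norm_divide norm_power)
  obtain g g' where g: "\<forall>t \<in> ball s 1. ((\<lambda>m. bcoef m t * w ^ m) sums g t)
       \<and> ((\<lambda>m. bcoef' m t * w ^ m) sums g' t) \<and> (g has_field_derivative g' t) (at t)"
  proof (rule series_and_derivative_comparison[of "ball s 1" "\<lambda>m. M * (cmod w ^ m / fact m)"
        "\<lambda>m t. bcoef m t * w ^ m" "\<lambda>m t. bcoef' m t * w ^ m"])
    show "((\<lambda>t. bcoef m t * w ^ m) has_field_derivative bcoef' m x * w ^ m) (at x)" for m x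
      by (rule DERIV_cmult_right[OF bcoef_deriv])
    show "\<forall>\<^sub>F n in sequentially. \<forall>x\<in>ball s 1. cmod (bcoef n x * w ^ n) \<le> M * (cmod w ^ n / fact n)"
      using le by (intro always_eventually) auto
  qed (use sm in auto)
  have eq: "g t = bser t w" "g' t = bser' t w" if "t \<in> ball s 1" for t
    using g that by (auto simp: bser_def bser'_def sums_iff)
  show "(\<lambda>m. bcoef m s * w ^ m) sums bser s w" "(\<lambda>m. bcoef' m s * w ^ m) sums bser' s w"
    using g eq by (metis centre_in_ball zero_less_one)+
  show "((\<lambda>s. bser s w) has_field_derivative bser' s w) (at s)"
    by (rule has_field_derivative_transform_within_open[of g _ _ "ball s 1"])
       (use g eq in \<open>auto simp: dist_commute\<close>)
qed

section \<open>Recurrences between neighbouring orders\<close>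

lemma bcoef_plus1: "of_nat (Suc m) * bcoef (Suc m) s = - bcoef m (s + 1)"
  by (simp add: bcoef_def algebra_simps del: of_nat_Suc) (simp add: field_simps)

lemma bcoef'_plus1: "of_nat (Suc m) * bcoef' (Suc m) s = - bcoef' m (s + 1)"
  by (simp add: bcoef'_def algebra_simps del: of_nat_Suc) (simp add: field_simps)

text \<open>The classical rule that differentiating z^(-s) J_s raises the order, here termwise in w;
  it is the source of the raising rule for the radial profile.\<close>

lemma bser_deriv: "((\<lambda>w. bser s w) has_field_derivative - bser (s + 1) w) (at w)"
proof -
  have "((\<lambda>w. \<Sum>m. bcoef m s * w ^ m) has_field_derivative (\<Sum>m. diffs (\<lambda>m. bcoef m s) m * w ^ m)) (at w)"
    by (rule termdiffs_strong_converges_everywhere) (use bser_sums sums_summable in blast)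
  also have "(\<lambda>m. diffs (\<lambda>m. bcoef m s) m * w ^ m) = (\<lambda>m. - (bcoef m (s + 1) * w ^ m))"
    by (simp add: diffs_def bcoef_plus1 del: of_nat_Suc)
  also have "(\<Sum>m. - (bcoef m (s + 1) * w ^ m)) = - bser (s + 1) w"
    by (rule sums_unique[symmetric]) (intro sums_minus bser_sums bser'_sums)
  finally show ?thesis unfolding bser_def[abs_def] .
qed

lemma bser'_deriv: "((\<lambda>w. bser' s w) has_field_derivative - bser' (s + 1) w) (at w)"
proof -
  have "((\<lambda>w. \<Sum>m. bcoef' m s * w ^ m) has_field_derivative (\<Sum>m. diffs (\<lambda>m. bcoef' m s) m * w ^ m)) (at w)"
    by (rule termdiffs_strong_converges_everywhere) (use bser'_sums sums_summable in blast)
  also have "(\<lambda>m. diffs (\<lambda>m. bcoef' m s) m * w ^ m) = (\<lambda>m. - (bcoef' m (s + 1) * w ^ m))"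
    by (simp add: diffs_def bcoef'_plus1 del: of_nat_Suc)
  also have "(\<Sum>m. - (bcoef' m (s + 1) * w ^ m)) = - bser' (s + 1) w"
    by (rule sums_unique[symmetric]) (intro sums_minus bser_sums bser'_sums)
  finally show ?thesis unfolding bser'_def[abs_def] .
qed

text \<open>The functional equation of \<open>rGamma\<close> turns the factor m + s, produced by w
  d/dw + s, into a shift of the order by -1. In the classical notation this is the derivative rule
  for z^s J_s.\<close>

lemma bser_minus1: "- w * bser (s + 1) w + s * bser s w = bser (s - 1) w"
proof -
  have "(\<lambda>m. - (bcoef m (s + 1) * w ^ m)) sums - bser (s + 1) w"
    by (intro sums_minus bser_sums bser'_sums)
  then have "(\<lambda>m. w * (- (bcoef m (s + 1) * w ^ m))) sums (w * - bser (s + 1) w)"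
    by (rule sums_mult)
  then have "(\<lambda>m. of_nat (Suc m) * bcoef (Suc m) s * w ^ Suc m) sums (- w * bser (s + 1) w)"
    by (simp only: bcoef_plus1) (simp add: algebra_simps)
  from sums_Suc[OF this] have "(\<lambda>m. of_nat m * bcoef m s * w ^ m) sums (- w * bser (s + 1) w)" by simp
  from sums_add[OF this sums_mult[OF bser_sums[of s w], of s]]
  have "(\<lambda>m. of_nat m * bcoef m s * w ^ m + s * (bcoef m s * w ^ m)) sums (- w * bser (s + 1) w + s * bser s w)" .
  moreover have "of_nat m * bcoef m s * w ^ m + s * (bcoef m s * w ^ m) = bcoef m (s - 1) * w ^ m" for m
  proof -
    have "(of_nat m + s) * rGamma (of_nat m + s + 1) = rGamma (of_nat m + s)" by (rule rGamma_plus1)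
    then have "bcoef m (s - 1) = (of_nat m + s) * bcoef m s" by (simp add: bcoef_def)
    then show ?thesis by (simp add: algebra_simps)
  qed
  ultimately have "(\<lambda>m. bcoef m (s - 1) * w ^ m) sums (- w * bser (s + 1) w + s * bser s w)" by simp
  then show ?thesis using bser_sums sums_unique2 by blast
qed

text \<open>The previous relation differentiated in the order. The extra \<open>bser s w\<close>
  comes from the explicit factor s, and later cancels the derivative of the logarithm.\<close>

lemma bser'_minus1: "- w * bser' (s + 1) w + s * bser' s w = bser' (s - 1) w - bser s w"
proof -
  have 1: "((\<lambda>s. bser (s + 1) w) has_field_derivative bser' (s + 1) w) (at s)"
    using bser_deriv_order by (subst DERIV_shift[symmetric])
  have 2: "((\<lambda>s. bser (s - 1) w) has_field_derivative bser' (s - 1) w) (at s)"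
    using bser_deriv_order[of w "s - 1"] DERIV_shift[of "\<lambda>s. bser s w" "bser' (s - 1) w" s "-1"] by simp
  have "((\<lambda>s. - w * bser (s + 1) w + s * bser s w) has_field_derivative
      (- w * bser' (s + 1) w + (1 * bser s w + bser' s w * s))) (at s)"
    by (intro DERIV_add DERIV_cmult DERIV_mult 1 bser_deriv_order DERIV_ident)
  from DERIV_unique[OF this[unfolded bser_minus1] 2] show ?thesis by (simp add: algebra_simps)
qed

text \<open>This is J_(-n) = (-1)^n J_n. The first n coefficients vanish at the zeros of
  \<open>rGamma\<close>, and the others are those of order n shifted by n places. It makes the
  quotient defining Y_n an indeterminate form 0/0.\<close>

lemma bser_minus_nat: "bser (- of_nat n) w = (- w) ^ n * bser (of_nat n) w"
proof (induction n)
  case (Suc n)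
  have *: "bcoef m (- of_nat (Suc n)) = (if m < Suc n then 0 else bcoef m (- of_nat (Suc n)))" for m
  proof -
    have "rGamma (of_nat m + (- of_nat (Suc n)) + 1 :: complex) = 0" if "m < Suc n"
    proof -
      have "of_nat m + (- of_nat (Suc n)) + 1 = - (of_nat (n - m) :: complex)"
        using that by (simp add: of_nat_diff)
      then show ?thesis by (simp add: rGamma_eq_zero_iff)
    qed
    then show ?thesis by (auto simp: bcoef_def)
  qed
  have sh: "bcoef (m + Suc n) (- of_nat (Suc n)) = (-1) ^ Suc n * bcoef m (of_nat (Suc n))" for m
  proof -
    have 1: "rGamma (of_nat (m + Suc n) + (- of_nat (Suc n)) + 1 :: complex) = inverse (fact m)"
      using Gamma_fact[of m, where ?'a = complex] by (simp add: rGamma_inverse_Gamma add.commute)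
    have 2: "rGamma (of_nat m + of_nat (Suc n) + 1 :: complex) = inverse (fact (m + Suc n))"
      using Gamma_fact[of "m + Suc n", where ?'a = complex] by (simp add: rGamma_inverse_Gamma add_ac)
    show ?thesis unfolding bcoef_def 1 2 by (simp only: power_add) (simp add: divide_inverse)
  qed
  have "(\<lambda>m. bcoef (m + Suc n) (- of_nat (Suc n)) * w ^ (m + Suc n)) sums
      (bser (- of_nat (Suc n)) w - (\<Sum>i<Suc n. bcoef i (- of_nat (Suc n)) * w ^ i))"
    by (rule sums_split_initial_segment[OF bser_sums])
  also have "(\<Sum>i<Suc n. bcoef i (- of_nat (Suc n)) * w ^ i) = 0"
    by (intro sum.neutral) (use * in \<open>metis lessThan_iff mult_zero_left\<close>)
  finally have "(\<lambda>m. (- w) ^ Suc n * (bcoef m (of_nat (Suc n)) * w ^ m)) sums bser (- of_nat (Suc n)) w"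
    unfolding sh by (simp add: power_add power_minus[of w] mult_ac)
  moreover have "(\<lambda>m. (- w) ^ Suc n * (bcoef m (of_nat (Suc n)) * w ^ m)) sums ((- w) ^ Suc n * bser (of_nat (Suc n)) w)"
    by (intro sums_mult bser_sums bser'_sums)
  ultimately show ?case by (rule sums_unique2)
qed simp

section \<open>Uniform bounds and Taylor remainders on the unit disc\<close>

lemma bounded_on_unit_disc:
  assumes "\<And>w. (f has_field_derivative f' w) (at (w::complex))"
  shows "\<exists>M>0. \<forall>w\<in>cball 0 1. cmod (f w) \<le> M"
proof -
  have "continuous_on (cball 0 1) f" using assms by (rule DERIV_continuous_on[OF DERIV_subset]) auto
  then have "bounded (f ` cball 0 1)" by (intro compact_imp_bounded compact_continuous_image) auto
  then show ?thesis by (auto simp: bounded_pos)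
qed

text \<open>The tail divided by w^n is again an everywhere convergent power series, hence bounded on
  the disc. Radius one suffices, as the series are used at |w| = |\<open>lam\<close>| \<rho> /
  4.\<close>

lemma power_series_remainder:
  assumes "\<And>w. (\<lambda>m. c m * w ^ m) sums f (w::complex)"
  shows "\<exists>M>0. \<forall>w\<in>cball 0 1. cmod (f w - (\<Sum>i<n. c i * w ^ i)) \<le> M * cmod w ^ n"
proof -
  have s: "(\<lambda>m. c (m + n) * w ^ (m + n)) sums (f w - (\<Sum>i<n. c i * w ^ i))" for w
    by (rule sums_split_initial_segment[OF assms])
  have sm: "summable (\<lambda>m. c (m + n) * w ^ m)" for w
  proof (cases "w = 0")
    case False
    then show ?thesis
      using summable_mult[OF sums_summable[OF s[of w]], of "1 / w ^ n"] by (simp add: power_add)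
  next
    case True
    then show ?thesis using summable_0_powser[of "\<lambda>m. c (m + n)"] by simp
  qed
  have d: "((\<lambda>w. \<Sum>m. c (m + n) * w ^ m) has_field_derivative (\<Sum>m. diffs (\<lambda>m. c (m + n)) m * w ^ m)) (at w)" for w
    by (rule termdiffs_strong_converges_everywhere[OF sm])
  obtain M where M: "M > 0" "\<And>w. w \<in> cball 0 1 \<Longrightarrow> cmod (\<Sum>m. c (m + n) * w ^ m) \<le> M"
    using bounded_on_unit_disc[OF d] by blast
  have "f w - (\<Sum>i<n. c i * w ^ i) = (\<Sum>m. c (m + n) * w ^ m) * w ^ n" for w
  proof -
    have "(\<lambda>m. c (m + n) * w ^ m * w ^ n) sums ((\<Sum>m. c (m + n) * w ^ m) * w ^ n)"
      by (intro sums_mult2 summable_sums sm)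
    then show ?thesis using s[of w] sums_unique2 by (simp add: power_add mult.assoc) blast
  qed
  then show ?thesis using M by (intro exI[of _ M]) (auto simp: norm_mult norm_power intro!: mult_right_mono)
qed

subsection \<open>Hankel functions of integer and half-integer order\<close>

text \<open>Splits J into two factors that are both entire in the order, so that the limit defining
  Y_n can be computed by complex differentiation.\<close>

lemma besselJ_eq:
  assumes "z \<noteq> 0"
  shows "besselJ \<mu> z = exp (of_real \<mu> * Ln (z / 2)) * bser (of_real \<mu>) ((z / 2)\<^sup>2)"
  using assms by (simp add: besselJ_def bser_def bcoef_def powr_def power_mult)

lemma tendsto_quotient_at_common_zero:
  fixes f g :: "complex \<Rightarrow> complex"
  assumes "(f has_field_derivative f') (at a)" "(g has_field_derivative g') (at a)"
    and "f a = 0" "g a = 0" "g' \<noteq> 0"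
  shows "((\<lambda>s. f s / g s) \<longlongrightarrow> f' / g') (at a)"
proof -
  have "((\<lambda>s. (f s - f a) / (s - a) / ((g s - g a) / (s - a))) \<longlongrightarrow> f' / g') (at a)"
    using assms by (intro tendsto_divide) (auto simp: has_field_derivative_iff)
  moreover have "eventually (\<lambda>s. (f s - f a) / (s - a) / ((g s - g a) / (s - a)) = f s / g s) (at a)"
    using assms by (auto simp: eventually_at_filter)
  ultimately show ?thesis by (rule Lim_transform_eventually)
qed

text \<open>Numerator and denominator of \<open>besselY_aux\<close> both vanish at order n, so the
  limit is the quotient of their derivatives in the order. The logarithm L arises from
  differentiating (z/2)^s and (z/2)^(-s); the two contributions coincide and give the factor
  2.\<close>

lemma besselY_nat:
  fixes n :: nat
  assumes z: "z \<noteq> 0"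
  defines "L \<equiv> Ln (z / 2)" and "w \<equiv> (z / 2)\<^sup>2"
  shows "besselY (real n) z = 1 / pi *
    (2 * L * exp (of_nat n * L) * bser (of_nat n) w + exp (of_nat n * L) * bser' (of_nat n) w
     + (-1) ^ n * exp (- of_nat n * L) * bser' (- of_nat n) w)"
proof -
  \<comment> \<open>The numerator of \<open>besselY_aux\<close>, extended to complex orders
    s.\<close>
  define N where "N s = exp (s * L) * bser s w * cos (s * pi) - exp (- s * L) * bser (- s) w" for s
  define a :: complex where "a = of_nat n"
  have cosa: "cos (a * pi) = (-1) ^ n"
    using cos_npi[of n] by (metis a_def cos_of_real of_real_mult of_real_of_nat_eq of_real_power of_real_minus of_real_1)
  have sina: "sin (a * pi) = 0"
    using sin_npi[of n] by (metis a_def sin_of_real of_real_mult of_real_of_nat_eq of_real_0)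
  have expL: "exp (- a * L) * (- w) ^ n = (-1) ^ n * exp (a * L)"
  proof -
    have "exp L = z / 2" unfolding L_def using z by simp
    then have "w = exp L * exp L" unfolding w_def power2_eq_square by metis
    then have "w = exp (2 * L)" by (simp add: exp_add[symmetric])
    then have "w ^ n = exp (2 * a * L)" unfolding a_def by (simp add: exp_of_nat_mult[symmetric] mult_ac)
    then show ?thesis by (simp add: power_minus[of w] exp_add[symmetric] algebra_simps)
  qed
  have neg: "exp (- a * L) * bser (- a) w = (-1) ^ n * exp (a * L) * bser a w"
    using expL by (simp add: a_def bser_minus_nat mult.assoc[symmetric])
  have N0: "N a = 0" unfolding N_def neg cosa by simp
  define N' where "N' = (-1) ^ n * (2 * L * exp (a * L) * bser a w + exp (a * L) * bser' a w
     + (-1) ^ n * exp (- a * L) * bser' (- a) w)"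
  have dm: "((\<lambda>s. bser (- s) w) has_field_derivative - bser' (- a) w) (at a)"
    using DERIV_chain2[where f = "\<lambda>s. bser s w" and g = uminus, OF bser_deriv_order[of w "- a"] DERIV_minus[OF DERIV_ident]]
    by simp
  have "(N has_field_derivative
       (exp (a * L) * L * bser a w + exp (a * L) * bser' a w) * cos (a * pi)
        + exp (a * L) * bser a w * (- sin (a * pi) * pi)
        - (- L * exp (- a * L) * bser (- a) w - exp (- a * L) * bser' (- a) w)) (at a)"
    unfolding N_def[abs_def]
    by (rule derivative_eq_intros dm bser_deriv_order refl)+ (simp add: algebra_simps)
  also have "(exp (a * L) * L * bser a w + exp (a * L) * bser' a w) * cos (a * pi)
        + exp (a * L) * bser a w * (- sin (a * pi) * pi)
        - (- L * exp (- a * L) * bser (- a) w - exp (- a * L) * bser' (- a) w) = N'"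
  proof -
    have sq: "((-1) ^ n * (-1) ^ n :: complex) = 1" by (simp flip: power_mult_distrib)
    have "(exp (a * L) * L * bser a w + exp (a * L) * bser' a w) * cos (a * pi)
        + exp (a * L) * bser a w * (- sin (a * pi) * pi)
        - (- L * exp (- a * L) * bser (- a) w - exp (- a * L) * bser' (- a) w)
       = (exp (a * L) * L * bser a w + exp (a * L) * bser' a w) * (-1) ^ n
        + L * (exp (- a * L) * bser (- a) w) + exp (- a * L) * bser' (- a) w"
      unfolding cosa sina by (simp add: algebra_simps)
    also have "\<dots> = N'"
      unfolding neg N'_def using sq by (simp add: algebra_simps)
    finally show ?thesis .
  qed
  finally have dN: "(N has_field_derivative N') (at a)" .
  have dS: "((\<lambda>s. sin (s * pi)) has_field_derivative ((-1) ^ n * pi)) (at a)"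
    by (rule derivative_eq_intros refl)+ (simp add: cosa)
  have "((\<lambda>s. N s / sin (s * pi)) \<longlongrightarrow> N' / ((-1) ^ n * pi)) (at a)"
    by (rule tendsto_quotient_at_common_zero[OF dN dS N0 sina]) simp
  \<comment> \<open>\<open>besselY\<close> takes the limit along real orders, a restriction of the
    complex limit just found.\<close>
  moreover have "filterlim complex_of_real (at a) (at (real n))"
  proof (rule filterlim_atI)
    show "(complex_of_real \<longlongrightarrow> a) (at (real n))"
      using tendsto_of_real[OF tendsto_ident_at[of "real n" UNIV], where ?'a = complex] by (simp add: a_def)
    show "eventually (\<lambda>\<mu>. complex_of_real \<mu> \<noteq> a) (at (real n))"
      using of_real_eq_iff[of _ "real n", where ?'a = complex]
      by (simp add: a_def eventually_at_filter del: of_real_eq_iff)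
  qed
  ultimately have "((\<lambda>\<mu>. N (of_real \<mu>) / sin (of_real \<mu> * of_real pi)) \<longlongrightarrow> N' / ((-1) ^ n * pi)) (at (real n))"
    by (rule filterlim_compose)
  moreover have "N (of_real \<mu>) / sin (of_real \<mu> * of_real pi) = besselY_aux \<mu> z" for \<mu>
    unfolding besselY_aux_def N_def besselJ_eq[OF z] by (simp add: L_def w_def)
  ultimately have "((\<lambda>\<mu>. besselY_aux \<mu> z) \<longlongrightarrow> N' / ((-1) ^ n * pi)) (at (real n))" by simp
  then have "Lim (at (real n)) (\<lambda>\<mu>. besselY_aux \<mu> z) = N' / ((-1) ^ n * pi)"
    by (intro tendsto_Lim) auto
  then have "besselY (real n) z = N' / ((-1) ^ n * pi)" by (simp add: besselY_def)
  then show ?thesis unfolding N'_def a_def by simp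
qed

lemma kk_nonzero: "lam \<noteq> 0 \<Longrightarrow> kk lam \<noteq> 0"
  by (simp add: kk_def)

lemma kk_squared: "(kk lam)\<^sup>2 = - lam"
proof (cases "lam = 0")
  case False
  have "(kk lam)\<^sup>2 = of_real (cmod lam) * exp (2 * (\<i> * complex_of_real ((pi + Arg lam) / 2)))"
    unfolding exp_double by (simp add: kk_def power_mult_distrib flip: of_real_power)
  also have "2 * (\<i> * complex_of_real ((pi + Arg lam) / 2)) = \<i> * pi + \<i> * Arg lam"
    by (simp add: algebra_simps)
  also have "of_real (cmod lam) * exp (\<i> * pi + \<i> * Arg lam) = - (of_real (cmod lam) * exp (\<i> * Arg lam))"
    by (simp add: exp_add)
  also have "of_real (cmod lam) * exp (\<i> * Arg lam) = lam"
    using Arg_eq[OF False] by simp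
  finally show ?thesis .
qed (simp add: kk_def)

lemma norm_kk: "cmod (kk lam) = sqrt (cmod lam)"
  by (simp add: kk_def norm_mult)

text \<open>The profile \<open>r\<^sup>-\<^sup>\<nu> k\<^sup>\<nu> H\<^sub>\<nu>(k r)\<close> as a function of \<open>\<rho> = r\<^sup>2\<close>, in which variable the coordinate
  derivatives of a radial function are polynomial in the coordinates.\<close>

definition hprof :: "real \<Rightarrow> complex \<Rightarrow> real \<Rightarrow> complex" where
  "hprof \<nu> lam \<rho> = of_real (\<rho> powr (- \<nu>)) * (kk lam * of_real (sqrt \<rho>)) powr (of_real \<nu>)
     * hankel1 \<nu> (kk lam * of_real (sqrt \<rho>))"

text \<open>A positive factor leaves the argument unchanged, so no branch is crossed: \<rho> enters
  the logarithm of k sqrt(\<rho>) / 2 only through the real \<open>ln \<rho>\<close>.\<close>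

lemma Ln_scale: "r > 0 \<Longrightarrow> z \<noteq> 0 \<Longrightarrow> Ln (of_real r * z) = of_real (ln r) + Ln z"
  by (simp add: Ln_times_of_real Ln_of_real)

text \<open>The powers combine because z^2 = -\<open>lam\<close> \<rho>. The logarithm multiplies
  only the regular part, which carries (-\<open>lam\<close>/2)^n; the singular part (-2/\<rho>)^n
  \<open>bser'\<close> is free of it.\<close>

lemma hprof_nat:
  fixes n :: nat
  assumes "lam \<noteq> 0" "\<rho> > 0"
  defines "L \<equiv> Ln (kk lam) + of_real (ln \<rho>) / 2 - of_real (ln 2)" and "w \<equiv> - lam * of_real \<rho> / 4"
  shows "hprof (real n) lam \<rho> =
    (- lam / 2) ^ n * (bser (of_nat n) w * (1 + 2 * \<i> / pi * L) + \<i> / pi * bser' (of_nat n) w)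
    + \<i> / pi * (- 2 / of_real \<rho>) ^ n * bser' (- of_nat n) w"
proof -
  define z where "z = kk lam * of_real (sqrt \<rho>)"
  have z: "z \<noteq> 0" using assms kk_nonzero by (simp add: z_def)
  have z2: "z\<^sup>2 = - lam * \<rho>" using assms by (simp add: z_def power_mult_distrib kk_squared flip: of_real_power)
  have zn: "(z / 2)\<^sup>2 = w" by (simp add: power_divide z2 w_def)
  have "Ln (z / 2) = Ln (of_real (sqrt \<rho> / 2) * kk lam)" by (simp add: z_def mult.commute)
  also have "\<dots> = of_real (ln (sqrt \<rho> / 2)) + Ln (kk lam)"
    using assms kk_nonzero by (intro Ln_scale) auto
  also have "ln (sqrt \<rho> / 2) = ln \<rho> / 2 - ln 2" using assms by (simp add: ln_div ln_sqrt)
  finally have L: "Ln (z / 2) = L" by (simp add: L_def)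
  have eL: "exp L = z / 2" using L z exp_Ln[of "z / 2"] by simp
  have e1: "exp (of_nat n * L) = (z / 2) ^ n" unfolding exp_of_nat_mult eL ..
  have e2: "exp (- of_nat n * L) = (2 / z) ^ n"
    unfolding mult_minus_left exp_minus e1 by (simp add: power_divide)
  have pw: "z powr (of_real (real n)) = z ^ n" using z by (simp add: powr_nat)
  have rh: "complex_of_real (\<rho> powr (- real n)) = 1 / of_real \<rho> ^ n"
    using assms(2) by (simp add: powr_minus powr_realpow divide_inverse)
  have 1: "1 / of_real \<rho> ^ n * z ^ n * (z / 2) ^ n = (- lam / 2) ^ n"
  proof -
    have "1 / of_real \<rho> ^ n * z ^ n * (z / 2) ^ n = (1 / of_real \<rho> * z * (z / 2)) ^ n"
      by (simp add: power_mult_distrib power_divide)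
    also have "1 / of_real \<rho> * z * (z / 2) = - lam / 2"
      using z2 assms(2) by (simp add: power2_eq_square field_simps)
    finally show ?thesis .
  qed
  have 2: "1 / of_real \<rho> ^ n * z ^ n * ((-1) ^ n * (2 / z) ^ n) = (- 2 / of_real \<rho>) ^ n"
  proof -
    have "1 / of_real \<rho> ^ n * z ^ n * ((-1) ^ n * (2 / z) ^ n) = (1 / of_real \<rho> * z * ((-1) * (2 / z))) ^ n"
      by (simp only: power_mult_distrib power_divide power_one)
    also have "1 / of_real \<rho> * z * ((-1) * (2 / z)) = - 2 / of_real \<rho>"
      using z by simp
    finally show ?thesis .
  qed
  have h: "hankel1 (real n) z = (z / 2) ^ n * (bser (of_nat n) w * (1 + 2 * \<i> / pi * L) + \<i> / pi * bser' (of_nat n) w)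
     + \<i> / pi * ((-1) ^ n * (2 / z) ^ n) * bser' (- of_nat n) w"
    unfolding hankel1_def besselY_nat[OF z] besselJ_eq[OF z] L zn
    using e1 e2 by (simp add: algebra_simps)
  have "hprof (real n) lam \<rho> = 1 / of_real \<rho> ^ n * z ^ n * hankel1 (real n) z"
    unfolding hprof_def z_def[symmetric] pw rh ..
  also have "\<dots> = (1 / of_real \<rho> ^ n * z ^ n * (z / 2) ^ n) * (bser (of_nat n) w * (1 + 2 * \<i> / pi * L) + \<i> / pi * bser' (of_nat n) w)
     + \<i> / pi * (1 / of_real \<rho> ^ n * z ^ n * ((-1) ^ n * (2 / z) ^ n)) * bser' (- of_nat n) w"
    unfolding h by (simp only: algebra_simps)
  finally show ?thesis unfolding 1 2 .
qed

text \<open>At half-integer order cos(\<nu> pi) = 0 and sin(\<nu> pi) = (-1)^n, so Y is -(-1)^n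
  times J of order -\<nu>. In the regular part the half-integer powers of \<rho> cancel and the odd
  power of k remains.\<close>

lemma hprof_half:
  fixes n :: nat and \<nu> :: real
  assumes "lam \<noteq> 0" "\<rho> > 0" and nu: "\<nu> = real n + 1 / 2"
  defines "w \<equiv> - lam * of_real \<rho> / 4"
  shows "hprof \<nu> lam \<rho> =
    of_real (2 powr (- \<nu>)) * kk lam ^ (2 * n + 1) * bser (of_real \<nu>) w
    - \<i> * (-1) ^ n * of_real (2 powr \<nu>) * of_real (\<rho> powr (- \<nu>)) * bser (- of_real \<nu>) w"
proof -
  define z where "z = kk lam * of_real (sqrt \<rho>)"
  define L where "L = Ln z"
  have z: "z \<noteq> 0" using assms kk_nonzero by (simp add: z_def)
  have z2: "z\<^sup>2 = - lam * \<rho>" using assms by (simp add: z_def power_mult_distrib kk_squared flip: of_real_power)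
  have zn: "(z / 2)\<^sup>2 = w" by (simp add: power_divide z2 w_def)
  have "Ln (z / 2) = Ln (of_real (1 / 2) * z)" by simp
  also have "\<dots> = of_real (ln (1 / 2)) + Ln z"
    using z by (intro Ln_scale) auto
  finally have L: "Ln (z / 2) = L - of_real (ln 2)" by (simp add: L_def ln_div)
  have nint: "\<nu> \<notin> \<int>"
  proof
    assume "\<nu> \<in> \<int>"
    then obtain j where "\<nu> = of_int j" by (auto elim: Ints_cases)
    then have "real_of_int (2 * j) = real_of_int (2 * int n + 1)" using nu by simp
    then have "2 * j = 2 * int n + 1" by (simp only: of_int_eq_iff)
    then show False by presburger
  qed
  have ang: "\<nu> * pi = real n * pi + pi / 2" unfolding nu by (simp add: algebra_simps)
  have c: "cos (complex_of_real (\<nu> * pi)) = 0"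
    unfolding cos_of_real ang by (simp add: cos_add)
  have s: "sin (complex_of_real (\<nu> * pi)) = (-1) ^ n"
    unfolding sin_of_real ang by (simp add: sin_add)
  have sq: "((-1) ^ n * (-1) ^ n :: complex) = 1" by (simp flip: power_mult_distrib)
  have Y: "besselY \<nu> z = - ((-1) ^ n * besselJ (- \<nu>) z)"
    using nint sq c s by (simp add: besselY_def besselY_aux_def field_simps flip: mult.assoc)
  have two: "exp (of_real \<nu> * of_real (ln 2)) = complex_of_real (2 powr \<nu>)"
     "exp (- (of_real \<nu> * of_real (ln 2))) = complex_of_real (2 powr (- \<nu>))"
    by (simp_all add: powr_def flip: of_real_mult of_real_minus exp_of_real)
  have e1: "z powr of_real \<nu> * exp (of_real \<nu> * Ln (z / 2)) = of_real (2 powr (- \<nu>)) * z ^ (2 * n + 1)"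
  proof -
    have "z powr of_real \<nu> * exp (of_real \<nu> * Ln (z / 2)) = exp (- (of_real \<nu> * of_real (ln 2))) * exp (2 * of_real \<nu> * L)"
      unfolding L using z by (simp add: powr_def L_def[symmetric] exp_add[symmetric] algebra_simps)
    also have "exp (2 * of_real \<nu> * L) = exp (of_nat (2 * n + 1) * L)" unfolding nu by (simp add: algebra_simps)
    also have "\<dots> = z ^ (2 * n + 1)" unfolding exp_of_nat_mult L_def using z by simp
    finally show ?thesis unfolding two .
  qed
  have e2: "z powr of_real \<nu> * exp (of_real (- \<nu>) * Ln (z / 2)) = of_real (2 powr \<nu>)"
    unfolding L two(1)[symmetric] using z by (simp add: powr_def L_def[symmetric] exp_add[symmetric] algebra_simps)
  have r: "complex_of_real (\<rho> powr (- \<nu>)) * of_real (sqrt \<rho>) ^ (2 * n + 1) = 1"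
  proof -
    have "sqrt \<rho> ^ (2 * n + 1) = \<rho> powr \<nu>"
    proof -
      have "sqrt \<rho> ^ (2 * n + 1) = (\<rho> powr (1/2)) powr real (2 * n + 1)"
        using assms by (subst powr_realpow) (auto simp: powr_half_sqrt)
      then show ?thesis unfolding powr_powr nu by (simp add: field_simps)
    qed
    then have "\<rho> powr (- \<nu>) * sqrt \<rho> ^ (2 * n + 1) = 1" using assms(2) by (simp add: powr_minus)
    then show ?thesis by (metis of_real_1 of_real_mult of_real_power)
  qed
  have "hprof \<nu> lam \<rho> = of_real (\<rho> powr (- \<nu>)) *
       ((z powr of_real \<nu> * exp (of_real \<nu> * Ln (z / 2))) * bser (of_real \<nu>) w
        - \<i> * (-1) ^ n * (z powr of_real \<nu> * exp (of_real (- \<nu>) * Ln (z / 2))) * bser (- of_real \<nu>) w)"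
    unfolding hprof_def z_def[symmetric] hankel1_def Y besselJ_eq[OF z] zn by (simp add: algebra_simps)
  also have "\<dots> = of_real (2 powr (- \<nu>)) * (of_real (\<rho> powr (- \<nu>)) * of_real (sqrt \<rho>) ^ (2 * n + 1)) * kk lam ^ (2 * n + 1) * bser (of_real \<nu>) w
    - \<i> * (-1) ^ n * of_real (2 powr \<nu>) * of_real (\<rho> powr (- \<nu>)) * bser (- of_real \<nu>) w"
    unfolding e1 e2 unfolding z_def power_mult_distrib by (simp only: algebra_simps)
  finally show ?thesis unfolding r by simp
qed

subsection \<open>Raising the order by differentiation\<close>

lemma bser_affine_deriv:
  "((\<lambda>r. bser s (- lam * r / 4)) has_field_derivative lam / 4 * bser (s + 1) (- lam * r / 4)) (at r)"
  by (rule DERIV_cong[OF DERIV_chain2[where f = "bser s", OF bser_deriv]])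
     (auto intro!: derivative_eq_intros)

lemma bser'_affine_deriv:
  "((\<lambda>r. bser' s (- lam * r / 4)) has_field_derivative lam / 4 * bser' (s + 1) (- lam * r / 4)) (at r)"
  by (rule DERIV_cong[OF DERIV_chain2[where f = "bser' s", OF bser'_deriv]])
     (auto intro!: derivative_eq_intros)

lemma DERIV_inverse_power:
  assumes "r \<noteq> (0::complex)"
  shows "((\<lambda>r. inverse r ^ n) has_field_derivative - of_nat n * inverse r ^ Suc n) (at r)"
  by (rule DERIV_cong[OF DERIV_power[OF DERIV_inverse[OF assms]]])
     (cases n; simp add: power2_eq_square algebra_simps)

text \<open>The explicit formula is read as a holomorphic function f of a complex variable,
  differentiated with the recurrences, and restricted to the positive axis. The regular part raises
  its order directly; the derivative of the logarithm leaves one stray term.\<close>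

lemma hprof_nat_deriv:
  fixes n :: nat
  assumes "lam \<noteq> 0" "\<rho> > 0"
  shows "(hprof (real n) lam has_vector_derivative - hprof (real n + 1) lam \<rho> / 2) (at \<rho>)"
proof -
  define f where "f = (\<lambda>r. (- lam / 2) ^ n * (bser (of_nat n) (- lam * r / 4)
        * (1 + 2 * \<i> / pi * (Ln (kk lam) + Ln r / 2 - of_real (ln 2)))
        + \<i> / pi * bser' (of_nat n) (- lam * r / 4))
      + \<i> / pi * ((-2) ^ n * inverse r ^ n * bser' (- of_nat n) (- lam * r / 4)))"
  define R where "R = complex_of_real \<rho>"
  have R: "R \<noteq> 0" "R \<notin> \<real>\<^sub>\<le>\<^sub>0" using assms by (auto simp: R_def)
  define w where "w = - lam * R / 4"
  define L where "L = Ln (kk lam) + Ln R / 2 - of_real (ln 2)"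
  have "(f has_field_derivative
      ((- lam / 2) ^ n * (lam / 4 * bser (of_nat n + 1) w * (1 + 2 * \<i> / pi * L)
          + bser (of_nat n) w * (\<i> / pi * inverse R) + \<i> / pi * (lam / 4 * bser' (of_nat n + 1) w))
       + \<i> / pi * ((-2) ^ n * ((- of_nat n * inverse R ^ Suc n) * bser' (- of_nat n) w
            + inverse R ^ n * (lam / 4 * bser' (- of_nat n + 1) w))))) (at R)"
    (is "(f has_field_derivative ?D) _")
  proof -
    have dL: "((\<lambda>r. 1 + 2 * \<i> / pi * (Ln (kk lam) + Ln r / 2 - of_real (ln 2))) has_field_derivative (\<i> / pi * inverse R)) (at R)"
      using R by (auto intro!: derivative_eq_intros simp: field_simps)
    show ?thesis unfolding f_def
      by (rule DERIV_cong,
          (rule DERIV_add DERIV_cmult DERIV_mult[OF bser_affine_deriv dL] bser'_affine_deriv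
              DERIV_mult[OF DERIV_cmult[OF DERIV_inverse_power[OF R(1)]] bser'_affine_deriv])+)
         (simp add: w_def L_def algebra_simps)
  qed
  also have "?D = - hprof (real n + 1) lam \<rho> / 2"
  proof -
    define p q c where "p = (- lam / 2) ^ n" and "q = (-2 :: complex) ^ n * inverse R ^ n" and "c = \<i> / complex_of_real pi"
    define C0 where "C0 = bser' (- of_nat n) w"
    define Cp where "Cp = bser' (- of_nat n + 1) w"
    define Cm where "Cm = bser' (- of_nat n - 1) w"
    \<comment> \<open>The lowering relation at order -n; its extra \<open>bser\<close> term is
      exactly what removes the stray term from the logarithm.\<close>
    have key: "- w * Cp - of_nat n * C0 = Cm - (- w) ^ n * bser (of_nat n) w"
      using bser'_minus1[of w "- of_nat n"] by (simp add: C0_def Cp_def Cm_def bser_minus_nat)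
    have pq: "q * (- w) ^ n = p"
    proof -
      have "q * (- w) ^ n = (-2 * inverse R * (- w)) ^ n" by (simp only: q_def power_mult_distrib)
      also have "-2 * inverse R * (- w) = - lam / 2" using R by (simp add: w_def field_simps)
      finally show ?thesis by (simp add: p_def)
    qed
    have rhs: "hprof (real n + 1) lam \<rho> =
       (- lam / 2) * p * (bser (of_nat n + 1) w * (1 + 2 * c * L) + c * bser' (of_nat n + 1) w)
      + c * ((-2) * inverse R * q) * Cm"
    proof -
      have h1: "hprof (real n + 1) lam \<rho> = hprof (real (Suc n)) lam \<rho>" by (simp add: add.commute)
      have s: "(- 2 / R) ^ n = q" unfolding q_def power_mult_distrib[symmetric] divide_inverse ..
      have w': "- lam * R / 4 = w" by (simp add: w_def)
      have L': "Ln (kk lam) + complex_of_real (ln \<rho>) / 2 - complex_of_real (ln 2) = L"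
        unfolding L_def R_def using Ln_of_real[OF assms(2)] by simp
      have n1: "complex_of_nat (Suc n) = of_nat n + 1" "- (complex_of_nat n + 1) = - of_nat n - 1" by simp_all
      show ?thesis unfolding h1 hprof_nat[OF assms] w' L' power_Suc R_def[symmetric] s n1
        unfolding p_def c_def Cm_def divide_inverse by (simp only: mult.assoc)
    qed
    have lhs: "?D = p * (lam / 4 * bser (of_nat n + 1) w * (1 + 2 * c * L)
          + bser (of_nat n) w * (c * inverse R) + c * (lam / 4 * bser' (of_nat n + 1) w))
       + c * (q * inverse R * (- of_nat n * C0 - w * Cp))"
      unfolding p_def[symmetric] c_def C0_def[symmetric] Cp_def[symmetric] q_def
      using R by (simp add: w_def) (simp add: field_simps)
    have "q * inverse R * (- of_nat n * C0 - w * Cp) = q * inverse R * (- w * Cp - of_nat n * C0)" by (simp add: algebra_simps)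
    also have "\<dots> = q * inverse R * Cm - inverse R * (q * (- w) ^ n) * bser (of_nat n) w"
      unfolding key by (simp add: algebra_simps)
    finally have e: "q * inverse R * (- of_nat n * C0 - w * Cp) = q * inverse R * Cm - inverse R * p * bser (of_nat n) w"
      unfolding pq .
    show ?thesis unfolding lhs e rhs by (simp add: algebra_simps)
  qed
  finally have D: "(f has_field_derivative - hprof (real n + 1) lam \<rho> / 2) (at (of_real \<rho>))"
    by (simp add: R_def)
  have "((\<lambda>r. f (of_real r)) has_vector_derivative - hprof (real n + 1) lam \<rho> / 2) (at \<rho>)"
    by (rule has_vector_derivative_real_field[OF D])
  moreover have "f (of_real r) = hprof (real n) lam r" if "r > 0" for r
  proof -
    have s: "(- 2 / complex_of_real r) ^ n = (-2) ^ n * inverse (complex_of_real r) ^ n"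
      unfolding power_mult_distrib[symmetric] divide_inverse ..
    show ?thesis
      unfolding f_def hprof_nat[OF assms(1) that] s using Ln_of_real[OF that] by simp
  qed
  ultimately show ?thesis
    using assms(2) has_vector_derivative_transform_within_open[of "\<lambda>r. f (of_real r)" _ \<rho> "{0<..}"] by simp
qed

text \<open>The regular part uses the raising rule, while \<rho>^(-\<nu>) times the series of order
  -\<nu> uses \<open>bser_minus1\<close> and lowers -\<nu> to -\<nu> - 1. The change of the
  constants is k^2 = -\<open>lam\<close>, a sign, and powers of 2.\<close>

lemma hprof_half_deriv:
  fixes n :: nat and \<nu> :: real
  assumes "lam \<noteq> 0" "\<rho> > 0" and nu: "\<nu> = real n + 1 / 2"
  shows "(hprof \<nu> lam has_vector_derivative - hprof (\<nu> + 1) lam \<rho> / 2) (at \<rho>)"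
proof -
  define c1 where "c1 = of_real (2 powr (- \<nu>)) * kk lam ^ (2 * n + 1)"
  define c2 where "c2 = \<i> * (-1) ^ n * of_real (2 powr \<nu>)"
  define s where "s = complex_of_real \<nu>"
  define f where "f = (\<lambda>r. c1 * bser s (- lam * r / 4) - c2 * (r powr (- s) * bser (- s) (- lam * r / 4)))"
  define R where "R = complex_of_real \<rho>"
  have R: "R \<noteq> 0" "R \<notin> \<real>\<^sub>\<le>\<^sub>0" using assms by (auto simp: R_def)
  define w where "w = - lam * R / 4"
  have "(f has_field_derivative c1 * (lam / 4 * bser (s + 1) w)
       - c2 * (- s * R powr (- s - 1) * bser (- s) w + R powr (- s) * (lam / 4 * bser (- s + 1) w))) (at R)"
    (is "(f has_field_derivative ?D) _")
    unfolding f_def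
    by (rule DERIV_cong,
        (rule DERIV_diff DERIV_cmult bser_affine_deriv DERIV_mult[OF has_field_derivative_powr[OF R(2)] bser_affine_deriv])+)
       (simp add: w_def algebra_simps)
  also have "?D = - hprof (\<nu> + 1) lam \<rho> / 2"
  proof -
    have p: "R powr (- s) = R * R powr (- s - 1)" using R by (simp add: powr_diff)
    have "- s * R powr (- s - 1) * bser (- s) w + R powr (- s) * (lam / 4 * bser (- s + 1) w)
        = R powr (- s - 1) * (- w * bser (- s + 1) w + (- s) * bser (- s) w)"
      unfolding p by (simp add: w_def algebra_simps)
    also have "\<dots> = R powr (- s - 1) * bser (- s - 1) w" unfolding bser_minus1 ..
    finally have e: "?D = c1 * (lam / 4 * bser (s + 1) w) - c2 * (R powr (- s - 1) * bser (- s - 1) w)" by simp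
    have nu': "\<nu> + 1 = real (Suc n) + 1 / 2" using nu by simp
    have w': "- lam * complex_of_real \<rho> / 4 = w" by (simp add: w_def R_def)
    have pr: "complex_of_real (\<rho> powr (- (\<nu> + 1))) = R powr (- s - 1)"
      using assms(2) powr_of_real[of \<rho> "- (\<nu> + 1)"] by (simp add: R_def s_def)
    have k: "kk lam ^ (2 * Suc n + 1) = - lam * kk lam ^ (2 * n + 1)"
      by (simp add: kk_squared[symmetric] power2_eq_square)
    have t1: "2 powr (- (\<nu> + 1)) = 2 powr (- \<nu>) / 2" by (simp add: powr_diff)
    have t2: "2 powr (\<nu> + 1) = 2 * 2 powr \<nu>" by (simp add: powr_add)
    have s1: "complex_of_real (\<nu> + 1) = s + 1" by (simp add: s_def)
    have s2: "- (s + 1) = - s - 1" by simp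
    have "hprof (\<nu> + 1) lam \<rho> = - lam / 2 * c1 * bser (s + 1) w + 2 * c2 * (R powr (- s - 1) * bser (- s - 1) w)"
      unfolding hprof_half[OF assms(1,2) nu'] w' pr k t1 t2 s1 s2 by (simp add: c1_def c2_def)
    then show ?thesis unfolding e by simp
  qed
  finally have D: "(f has_field_derivative - hprof (\<nu> + 1) lam \<rho> / 2) (at (of_real \<rho>))"
    by (simp add: R_def)
  have "((\<lambda>r. f (of_real r)) has_vector_derivative - hprof (\<nu> + 1) lam \<rho> / 2) (at \<rho>)"
    by (rule has_vector_derivative_real_field[OF D])
  moreover have "f (of_real r) = hprof \<nu> lam r" if "r > 0" for r
  proof -
    have "complex_of_real (r powr (- \<nu>)) = of_real r powr (- s)"
      using that powr_of_real[of r "- \<nu>"] by (simp add: s_def)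
    then show ?thesis
      unfolding f_def hprof_half[OF assms(1) that nu] by (simp add: s_def c1_def c2_def)
  qed
  ultimately show ?thesis
    using assms(2) has_vector_derivative_transform_within_open[of "\<lambda>r. f (of_real r)" _ \<rho> "{0<..}"] by simp
qed

lemma half_integer_cases:
  fixes \<nu> :: real
  assumes "2 * \<nu> \<in> \<nat>"
  obtains n where "\<nu> = real n" | n where "\<nu> = real n + 1 / 2"
proof -
  obtain m where m: "2 * \<nu> = real m" using assms by (auto elim: Nats_cases)
  show ?thesis
  proof (cases "even m")
    case True
    then obtain n where "m = 2 * n" by blast
    then show ?thesis using m that(1)[of n] by simp
  next
    case False
    then obtain n where "m = 2 * n + 1" using oddE by blast
    then show ?thesis using m that(2)[of n] by simp
  qed
qed

lemma hprof_deriv: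
  assumes "lam \<noteq> 0" "\<rho> > 0" "2 * \<nu> \<in> \<nat>"
  shows "(hprof \<nu> lam has_vector_derivative - hprof (\<nu> + 1) lam \<rho> / 2) (at \<rho>)"
  using assms(3) by (rule half_integer_cases) (use hprof_nat_deriv hprof_half_deriv assms(1,2) in auto)

subsection \<open>Expansion at the origin\<close>

text \<open>Leading coefficient at the origin, from the classical H_\<nu>(z) ~ -(i/pi) Gamma(\<nu>)
  (2/z)^\<nu>: the profile behaves like this constant times \<rho>^(-\<nu>).\<close>

definition hconst :: "real \<Rightarrow> complex" where
  "hconst \<nu> = - \<i> * of_real (2 powr \<nu> * Gamma \<nu> / pi)"

lemma hconst_plus1: "\<nu> > 0 \<Longrightarrow> hconst (\<nu> + 1) = 2 * of_real \<nu> * hconst \<nu>"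
  by (simp add: hconst_def powr_add Gamma_plus1 nonpos_Ints_def)

text \<open>Apply ln y \<le> y - 1 to y = 1/sqrt t. This is the half power that pays for the
  logarithm at integer order.\<close>

lemma sqrt_mult_abs_ln_le:
  assumes "0 < t" "t \<le> 1"
  shows "sqrt t * \<bar>ln t\<bar> \<le> 2"
proof -
  have "ln (1 / sqrt t) \<le> 1 / sqrt t - 1" using assms by (intro ln_le_minus_one) auto
  moreover have "ln (1 / sqrt t) = \<bar>ln t\<bar> / 2" using assms by (simp add: ln_div ln_sqrt abs_if)
  ultimately have "\<bar>ln t\<bar> \<le> 2 * (1 / sqrt t)" by simp
  then have "sqrt t * \<bar>ln t\<bar> \<le> sqrt t * (2 * (1 / sqrt t))"
    using assms by (intro mult_left_mono) auto
  then show ?thesis using assms by simp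
qed

text \<open>Only the imaginary part depends on the argument of \<open>lam\<close>, and the principal
  branch bounds it by pi; hence the estimate is uniform in that argument. The 5 covers pi < 4 and ln
  2 \<le> 1.\<close>

lemma norm_Ln_kk_le:
  assumes "lam \<noteq> 0" "\<rho> > 0"
  shows "cmod (Ln (kk lam) + of_real (ln \<rho>) / 2 - of_real (ln 2)) \<le> \<bar>ln (cmod lam * \<rho>)\<bar> / 2 + 5"
proof -
  have k: "kk lam \<noteq> 0" using assms kk_nonzero by blast
  have re: "Re (Ln (kk lam) + of_real (ln \<rho>) / 2 - of_real (ln 2)) = ln (cmod lam * \<rho>) / 2 - ln 2"
    using assms k by (simp add: norm_kk ln_sqrt ln_mult)
  have im: "\<bar>Im (Ln (kk lam) + of_real (ln \<rho>) / 2 - of_real (ln 2))\<bar> \<le> pi"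
    using mpi_less_Im_Ln[OF k] Im_Ln_le_pi[OF k] by auto
  have "ln 2 \<le> (1::real)" using ln_le_minus_one[of "2::real"] by simp
  moreover have "ln 2 \<ge> (0::real)" by simp
  ultimately show ?thesis
    using cmod_le[of "Ln (kk lam) + of_real (ln \<rho>) / 2 - of_real (ln 2)"] im pi_less_4 unfolding re by linarith
qed

text \<open>At a nonpositive integer -j the function \<open>rGamma\<close> has a simple zero with
  derivative (-1)^j j!. The order -(m + 2) keeps both indices 0 and 1 in that range.\<close>

lemma bcoef'_neg_nat:
  "bcoef' 0 (- of_nat (m + 2)) = (-1) ^ (m + 1) * fact (m + 1)"
  "bcoef' 1 (- of_nat (m + 2)) = (-1) ^ (m + 1) * fact m"
proof -
  have d: "deriv rGamma (- of_nat j :: complex) = (-1) ^ j * fact j" for j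
    by (rule DERIV_imp_deriv[OF has_field_derivative_rGamma_nonpos_int])
  have "of_nat 0 + (- of_nat (m + 2)) + 1 = - (of_nat (m + 1) :: complex)" by simp
  then show "bcoef' 0 (- of_nat (m + 2)) = (-1) ^ (m + 1) * fact (m + 1)"
    unfolding bcoef'_def by (simp only: d) simp
  have "of_nat 1 + (- of_nat (m + 2)) + 1 = - (of_nat m :: complex)" by simp
  then show "bcoef' 1 (- of_nat (m + 2)) = (-1) ^ (m + 1) * fact m"
    unfolding bcoef'_def by (simp only: d) simp
qed

text \<open>The first two Taylor terms of the singular part give the main term. The error is its
  remainder, of order t^2, plus the whole regular part, of order t^n with a logarithm.\<close>

lemma hprof_nat_asymp:
  fixes n :: nat
  assumes n: "n \<ge> 2"
  shows "\<exists>C>0. \<forall>lam \<rho>. lam \<noteq> 0 \<longrightarrow> \<rho> > 0 \<longrightarrow> cmod lam * \<rho> \<le> 1 \<longrightarrow>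
    cmod (of_real (\<rho> ^ n) * hprof (real n) lam \<rho> - hconst (real n) * (1 - lam * of_real \<rho> / (4 * (of_nat n - 1))))
      \<le> C * ((cmod lam * \<rho>)\<^sup>2 + (cmod lam * \<rho>) powr (real n - 1 / 2))"
proof -
  obtain m where m: "n = m + 2" using n le_Suc_ex by (metis add.commute)
  obtain A where A: "A > 0" "\<And>w. w \<in> cball 0 1 \<Longrightarrow> cmod (bser (of_nat n) w) \<le> A"
    using bounded_on_unit_disc[OF bser_deriv] by blast
  obtain B where B: "B > 0" "\<And>w. w \<in> cball 0 1 \<Longrightarrow> cmod (bser' (of_nat n) w) \<le> B"
    using bounded_on_unit_disc[OF bser'_deriv] by blast
  obtain M where M: "M > 0" "\<And>w. w \<in> cball 0 1 \<Longrightarrow>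
      cmod (bser' (- of_nat n) w - (\<Sum>i<2. bcoef' i (- of_nat n) * w ^ i)) \<le> M * cmod w ^ 2"
    using power_series_remainder[OF bser'_sums, of "- of_nat n" 2] by blast
  \<comment> \<open>13 = 11 + 2: the factor with L is at most |ln t| + 11, and sqrt t |ln t| is at
    most 2.\<close>
  define C where "C = 13 * A + B + 2 ^ n * M"
  have "cmod (of_real (\<rho> ^ n) * hprof (real n) lam \<rho> - hconst (real n) * (1 - lam * of_real \<rho> / (4 * (of_nat n - 1))))
      \<le> C * ((cmod lam * \<rho>)\<^sup>2 + (cmod lam * \<rho>) powr (real n - 1 / 2))"
    if h: "lam \<noteq> 0" "\<rho> > 0" "cmod lam * \<rho> \<le> 1" for lam \<rho>
  proof -
    define t where "t = cmod lam * \<rho>"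
    have t: "0 < t" "t \<le> 1" using h by (auto simp: t_def)
    define w where "w = - lam * of_real \<rho> / 4"
    define L where "L = Ln (kk lam) + of_real (ln \<rho>) / 2 - of_real (ln 2)"
    have nw: "cmod w = t / 4" using h by (simp add: w_def t_def norm_mult)
    then have wb: "w \<in> cball 0 1" using t by simp
    define X where "X = bser (of_nat n) w * (1 + 2 * \<i> / pi * L) + \<i> / pi * bser' (of_nat n) w"
    define Y where "Y = bser' (- of_nat n) w - (\<Sum>i<2. bcoef' i (- of_nat n) * w ^ i)"
    have p0: "complex_of_real (\<rho> ^ n) * (- lam / 2) ^ n = (- lam * of_real \<rho> / 2) ^ n"
      unfolding of_real_power power_mult_distrib[symmetric] by (simp add: mult.commute)
    have p1: "complex_of_real (\<rho> ^ n) * (- 2 / of_real \<rho>) ^ n = (- 2) ^ n"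
      unfolding of_real_power power_mult_distrib[symmetric] using h by simp
    have lead: "(- 2) ^ n * (\<i> / pi * (\<Sum>i<2. bcoef' i (- of_nat n) * w ^ i))
        = hconst (real n) * (1 - lam * of_real \<rho> / (4 * (of_nat n - 1)))"
    proof -
      have S: "(\<Sum>i<2. bcoef' i (- of_nat n) * w ^ i) = (-1) ^ (m + 1) * (fact (m + 1) + fact m * w)"
        using bcoef'_neg_nat[of m] unfolding m by (simp add: lessThan_nat_numeral numeral_2_eq_2 algebra_simps)
      have f: "fact (m + 1) + fact m * w = (fact (m + 1) :: complex) * (1 + w / of_nat (m + 1))"
      proof -
        define q where "q = complex_of_nat (m + 1)"
        have "q \<noteq> 0" unfolding q_def of_nat_eq_0_iff by simp
        moreover have "fact (m + 1) = q * fact m" by (simp add: q_def)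
        ultimately show ?thesis unfolding q_def[symmetric] by (simp add: distrib_left)
      qed
      have g: "Gamma (real n) = fact (m + 1)" using Gamma_fact[of "m + 1", where ?'a = real] by (simp add: m add.commute)
      have s: "(- 2 :: complex) ^ n * (-1) ^ (m + 1) = - (2 ^ n)"
        unfolding m by (induction m) auto
      have r: "(2::real) powr real n = 2 ^ n" by (simp add: powr_realpow)
      have ww: "1 + w / of_nat (m + 1) = 1 - lam * of_real \<rho> / (4 * (of_nat n - 1))" by (simp add: w_def m)
      have "(- 2) ^ n * (\<i> / pi * (\<Sum>i<2. bcoef' i (- of_nat n) * w ^ i))
         = ((- 2) ^ n * (-1) ^ (m + 1)) * (\<i> / pi * fact (m + 1)) * (1 + w / of_nat (m + 1))"
        unfolding S f by (simp only: mult_ac)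
      also have "\<dots> = hconst (real n) * (1 - lam * of_real \<rho> / (4 * (of_nat n - 1)))"
        unfolding s ww hconst_def g r by simp
      finally show ?thesis .
    qed
    have eq: "of_real (\<rho> ^ n) * hprof (real n) lam \<rho> - hconst (real n) * (1 - lam * of_real \<rho> / (4 * (of_nat n - 1)))
       = (- lam * of_real \<rho> / 2) ^ n * X + (- 2) ^ n * (\<i> / pi * Y)"
    proof -
      have "of_real (\<rho> ^ n) * hprof (real n) lam \<rho> =
          (complex_of_real (\<rho> ^ n) * (- lam / 2) ^ n) * X
          + \<i> / pi * (complex_of_real (\<rho> ^ n) * (- 2 / of_real \<rho>) ^ n) * bser' (- of_nat n) w"
        unfolding hprof_nat[OF h(1,2)] X_def w_def L_def by (simp only: distrib_left mult_ac)
      also have "\<dots> = (- lam * of_real \<rho> / 2) ^ n * X + (- 2) ^ n * (\<i> / pi * bser' (- of_nat n) w)"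
        unfolding p0 p1 by (simp only: mult_ac)
      also have "bser' (- of_nat n) w = Y + (\<Sum>i<2. bcoef' i (- of_nat n) * w ^ i)" by (simp add: Y_def)
      finally show ?thesis unfolding lead[symmetric] by (simp only: distrib_left) simp
    qed
    have pi1: "1 / pi \<le> 1" "2 / pi \<le> 1" using pi_gt3 by auto
    have nX: "cmod X \<le> A * (\<bar>ln t\<bar> + 11) + B"
    proof -
      have nL: "cmod L \<le> \<bar>ln t\<bar> / 2 + 5" unfolding L_def t_def by (rule norm_Ln_kk_le[OF h(1,2)])
      have "cmod (1 + 2 * \<i> / pi * L) \<le> 1 + cmod (2 * \<i> / pi * L)" using norm_triangle_ineq[of 1 "2 * \<i> / pi * L"] by simp
      also have "cmod (2 * \<i> / pi * L) = 2 / pi * cmod L" by (simp add: norm_mult norm_divide)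
      also have "\<dots> \<le> 1 * cmod L" using pi1 by (intro mult_right_mono) auto
      finally have l1: "cmod (1 + 2 * \<i> / pi * L) \<le> \<bar>ln t\<bar> + 11" using nL by linarith
      have "cmod (bser (of_nat n) w * (1 + 2 * \<i> / pi * L)) \<le> A * (\<bar>ln t\<bar> + 11)"
        unfolding norm_mult using A wb l1 by (intro mult_mono) auto
      moreover have "cmod (\<i> / pi * bser' (of_nat n) w) \<le> 1 * B"
        unfolding norm_mult using B wb pi1 by (intro mult_mono) (auto simp: norm_divide)
      ultimately show ?thesis unfolding X_def by (intro norm_triangle_le) simp
    qed
    have n1: "cmod ((- lam * of_real \<rho> / 2) ^ n * X) \<le> (13 * A + B) * t powr (real n - 1 / 2)"
    proof -
      have "cmod (- lam * of_real \<rho> / 2) = t / 2" using h by (simp add: t_def norm_mult)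
      then have "cmod ((- lam * of_real \<rho> / 2) ^ n) = (t / 2) ^ n" by (simp only: norm_power)
      also have "\<dots> \<le> t ^ n" using t by (intro power_mono) auto
      finally have "cmod ((- lam * of_real \<rho> / 2) ^ n * X) \<le> t ^ n * (A * (\<bar>ln t\<bar> + 11) + B)"
        unfolding norm_mult using nX t by (intro mult_mono) auto
      also have "t ^ n = t powr (real n - 1 / 2) * sqrt t"
      proof -
        have "sqrt t = t powr (1 / 2)" using t by (simp add: powr_half_sqrt)
        then have "t powr (real n - 1 / 2) * sqrt t = t powr (real n - 1 / 2 + 1 / 2)" by (simp only: powr_add)
        then show ?thesis using t by (simp add: powr_realpow)
      qed
      also have "t powr (real n - 1 / 2) * sqrt t * (A * (\<bar>ln t\<bar> + 11) + B)
          = t powr (real n - 1 / 2) * (A * (sqrt t * \<bar>ln t\<bar>) + (11 * A + B) * sqrt t)"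
        by (simp add: algebra_simps)
      also have "\<dots> \<le> t powr (real n - 1 / 2) * (A * 2 + (11 * A + B) * 1)"
        using sqrt_mult_abs_ln_le[OF t] t A(1) B(1) by (intro mult_left_mono add_mono) auto
      finally show ?thesis by (simp add: algebra_simps)
    qed
    have n2: "cmod ((- 2) ^ n * (\<i> / pi * Y)) \<le> 2 ^ n * M * t\<^sup>2"
    proof -
      have "cmod Y \<le> M * cmod w ^ 2" unfolding Y_def by (rule M(2)[OF wb])
      also have "\<dots> \<le> M * t\<^sup>2" unfolding nw using M(1) t by (intro mult_left_mono power_mono) auto
      finally have "cmod (\<i> / pi * Y) \<le> 1 * (M * t\<^sup>2)"
        unfolding norm_mult using pi1 M(1) by (intro mult_mono) (auto simp: norm_divide)
      then have "2 ^ n * cmod (\<i> / pi * Y) \<le> 2 ^ n * (M * t\<^sup>2)" by simp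
      moreover have "cmod ((- 2) ^ n * (\<i> / pi * Y)) = 2 ^ n * cmod (\<i> / pi * Y)"
        unfolding norm_mult[of "(- 2) ^ n"] norm_power by simp
      ultimately show ?thesis by (simp only: mult.assoc)
    qed
    have "cmod ((- lam * of_real \<rho> / 2) ^ n * X + (- 2) ^ n * (\<i> / pi * Y))
        \<le> (13 * A + B) * t powr (real n - 1 / 2) + 2 ^ n * M * t\<^sup>2"
      by (rule norm_triangle_le) (use n1 n2 in linarith)
    also have "\<dots> \<le> C * t powr (real n - 1 / 2) + C * t\<^sup>2"
      unfolding C_def using A(1) B(1) M(1) by (intro add_mono[OF mult_right_mono mult_right_mono]) auto
    finally show ?thesis unfolding eq t_def by (simp add: algebra_simps)
  qed
  moreover have "C > 0" unfolding C_def using A(1) B(1) M(1) by (intro add_pos_pos) auto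
  ultimately show ?thesis by blast
qed

text \<open>The reflection formula rewrites rGamma(1 - \<nu>) through Gamma(\<nu>), with sin(pi
  \<nu>) = (-1)^n; one step of the functional equation gives the second coefficient.\<close>

lemma bcoef_neg_half:
  fixes n :: nat
  assumes nu: "\<nu> = real n + 1 / 2" and "n \<ge> 1"
  shows "bcoef 0 (- of_real \<nu>) = of_real ((-1) ^ n * Gamma \<nu> / pi)"
    and "bcoef 1 (- of_real \<nu>) = of_real ((-1) ^ n * Gamma \<nu> / pi) / (of_real \<nu> - 1)"
proof -
  have ang: "\<nu> * pi = real n * pi + pi / 2" unfolding nu by (simp add: algebra_simps)
  have s: "sin (complex_of_real pi * of_real \<nu>) = (-1) ^ n"
  proof -
    have "sin (complex_of_real pi * of_real \<nu>) = of_real (sin (\<nu> * pi))"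
      by (metis mult.commute of_real_mult sin_of_real)
    then show ?thesis unfolding ang by (simp add: sin_add)
  qed
  have G: "Gamma \<nu> > 0" using nu by (intro Gamma_real_pos) auto
  have "rGamma (complex_of_real \<nu>) * rGamma (1 - of_real \<nu>) = (-1) ^ n / pi"
    using rGamma_reflection_complex[of "complex_of_real \<nu>"] s by simp
  moreover have "rGamma (complex_of_real \<nu>) = 1 / of_real (Gamma \<nu>)"
    by (simp add: rGamma_inverse_Gamma Gamma_complex_of_real divide_inverse)
  ultimately have r: "rGamma (1 - complex_of_real \<nu>) = of_real ((-1) ^ n * Gamma \<nu> / pi)"
    using G by (simp add: divide_eq_eq mult.commute)
  then show "bcoef 0 (- of_real \<nu>) = of_real ((-1) ^ n * Gamma \<nu> / pi)"
    by (simp add: bcoef_def)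
  have "(1 - complex_of_real \<nu>) * rGamma (1 - of_real \<nu> + 1) = rGamma (1 - of_real \<nu>)" by (rule rGamma_plus1)
  moreover have "bcoef 1 (- of_real \<nu>) = - rGamma (1 - of_real \<nu> + 1)" by (simp add: bcoef_def algebra_simps)
  ultimately have "(of_real \<nu> - 1) * bcoef 1 (- of_real \<nu>) = of_real ((-1) ^ n * Gamma \<nu> / pi)"
    unfolding r[symmetric] by (simp add: algebra_simps)
  moreover have "complex_of_real \<nu> - 1 \<noteq> 0"
    using assms by (metis eq_iff_diff_eq_0 of_real_eq_1_iff add_cancel_left_right field_sum_of_halves
        le_add_same_cancel1 less_add_same_cancel1 not_less of_nat_1 of_nat_le_iff zero_less_divide_1_iff zero_less_numeral)
  ultimately show "bcoef 1 (- of_real \<nu>) = of_real ((-1) ^ n * Gamma \<nu> / pi) / (of_real \<nu> - 1)"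
    by (simp add: field_simps)
qed

text \<open>Here the regular part is free of logarithms: k^(2n+1) has modulus
  |\<open>lam\<close>|^\<nu>, so it contributes exactly the order t^\<nu>.\<close>

lemma hprof_half_asymp:
  fixes n :: nat
  assumes nu: "\<nu> = real n + 1 / 2" and n: "n \<ge> 1"
  shows "\<exists>C>0. \<forall>lam \<rho>. lam \<noteq> 0 \<longrightarrow> \<rho> > 0 \<longrightarrow> cmod lam * \<rho> \<le> 1 \<longrightarrow>
    cmod (of_real (\<rho> powr \<nu>) * hprof \<nu> lam \<rho> - hconst \<nu> * (1 - lam * of_real \<rho> / (4 * (of_real \<nu> - 1))))
      \<le> C * ((cmod lam * \<rho>)\<^sup>2 + (cmod lam * \<rho>) powr \<nu>)"
proof -
  define s where "s = complex_of_real \<nu>"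
  obtain A where A: "A > 0" "\<And>w. w \<in> cball 0 1 \<Longrightarrow> cmod (bser s w) \<le> A"
    using bounded_on_unit_disc[OF bser_deriv] by blast
  obtain M where M: "M > 0" "\<And>w. w \<in> cball 0 1 \<Longrightarrow>
      cmod (bser (- s) w - (\<Sum>i<2. bcoef i (- s) * w ^ i)) \<le> M * cmod w ^ 2"
    using power_series_remainder[OF bser_sums, of "- s" 2] by blast
  define C where "C = A + 2 powr \<nu> * M"
  have "cmod (of_real (\<rho> powr \<nu>) * hprof \<nu> lam \<rho> - hconst \<nu> * (1 - lam * of_real \<rho> / (4 * (of_real \<nu> - 1))))
      \<le> C * ((cmod lam * \<rho>)\<^sup>2 + (cmod lam * \<rho>) powr \<nu>)"
    if h: "lam \<noteq> 0" "\<rho> > 0" "cmod lam * \<rho> \<le> 1" for lam \<rho>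
  proof -
    define t where "t = cmod lam * \<rho>"
    have t: "0 < t" "t \<le> 1" using h by (auto simp: t_def)
    define w where "w = - lam * of_real \<rho> / 4"
    have nw: "cmod w = t / 4" using h by (simp add: w_def t_def norm_mult)
    then have wb: "w \<in> cball 0 1" using t by simp
    define c where "c = \<i> * (-1) ^ n * complex_of_real (2 powr \<nu>)"
    define Y where "Y = bser (- s) w - (\<Sum>i<2. bcoef i (- s) * w ^ i)"
    have lead: "- c * (\<Sum>i<2. bcoef i (- s) * w ^ i) = hconst \<nu> * (1 - lam * of_real \<rho> / (4 * (of_real \<nu> - 1)))"
    proof -
      define g where "g = complex_of_real ((-1) ^ n * Gamma \<nu> / pi)"
      have "(\<Sum>i<2. bcoef i (- s) * w ^ i) = g * (1 + w / (of_real \<nu> - 1))"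
        using bcoef_neg_half[OF assms] unfolding s_def g_def[symmetric]
        by (simp add: lessThan_nat_numeral numeral_2_eq_2 distrib_left)
      moreover have "- c * g = hconst \<nu>"
        unfolding c_def g_def hconst_def by (simp add: power_mult_distrib[symmetric])
      moreover have "1 + w / (of_real \<nu> - 1) = 1 - lam * of_real \<rho> / (4 * (of_real \<nu> - 1))"
        by (simp add: w_def)
      ultimately show ?thesis by (metis mult.assoc)
    qed
    have rr: "complex_of_real (\<rho> powr \<nu>) * of_real (\<rho> powr (- \<nu>)) = 1"
      using h(2) by (simp add: powr_minus flip: of_real_mult)
    have eq: "of_real (\<rho> powr \<nu>) * hprof \<nu> lam \<rho> - hconst \<nu> * (1 - lam * of_real \<rho> / (4 * (of_real \<nu> - 1)))
       = of_real (\<rho> powr \<nu>) * (of_real (2 powr (- \<nu>)) * kk lam ^ (2 * n + 1) * bser s w) - c * Y"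
    proof -
      have "of_real (\<rho> powr \<nu>) * hprof \<nu> lam \<rho> =
          of_real (\<rho> powr \<nu>) * (of_real (2 powr (- \<nu>)) * kk lam ^ (2 * n + 1) * bser s w)
          - c * (complex_of_real (\<rho> powr \<nu>) * of_real (\<rho> powr (- \<nu>))) * bser (- s) w"
        unfolding hprof_half[OF h(1,2) nu] w_def s_def c_def by (simp only: right_diff_distrib mult_ac)
      also have "bser (- s) w = Y + (\<Sum>i<2. bcoef i (- s) * w ^ i)" by (simp add: Y_def)
      finally show ?thesis unfolding lead[symmetric] rr by (simp add: distrib_left)
    qed
    have n1: "cmod (of_real (\<rho> powr \<nu>) * (of_real (2 powr (- \<nu>)) * kk lam ^ (2 * n + 1) * bser s w)) \<le> A * t powr \<nu>"
    proof -
      have k: "cmod (kk lam ^ (2 * n + 1)) = cmod lam powr \<nu>"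
      proof -
        have "cmod (kk lam ^ (2 * n + 1)) = (cmod lam powr (1/2)) powr real (2 * n + 1)"
          using h by (subst powr_realpow) (auto simp: norm_mult norm_power norm_kk powr_half_sqrt)
        then show ?thesis unfolding powr_powr nu by (simp add: field_simps)
      qed
      have "2 powr (- \<nu>) \<le> (2::real) powr 0" using nu by (intro powr_mono) auto
      then have "2 powr (- \<nu>) * cmod (bser s w) \<le> 1 * A" using A wb by (intro mult_mono) auto
      then have "t powr \<nu> * (2 powr (- \<nu>) * cmod (bser s w)) \<le> t powr \<nu> * A" by (intro mult_left_mono) auto
      moreover have "cmod (of_real (\<rho> powr \<nu>) * (of_real (2 powr (- \<nu>)) * kk lam ^ (2 * n + 1) * bser s w))
          = t powr \<nu> * (2 powr (- \<nu>) * cmod (bser s w))"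
        unfolding norm_mult k t_def using h by (simp add: powr_mult)
      ultimately show ?thesis by (simp add: mult.commute)
    qed
    have n2: "cmod (c * Y) \<le> 2 powr \<nu> * M * t\<^sup>2"
    proof -
      have "cmod Y \<le> M * cmod w ^ 2" unfolding Y_def by (rule M(2)[OF wb])
      also have "\<dots> \<le> M * t\<^sup>2" unfolding nw using M(1) t by (intro mult_left_mono power_mono) auto
      finally show ?thesis by (simp add: c_def norm_mult norm_power)
    qed
    have "cmod (of_real (\<rho> powr \<nu>) * (of_real (2 powr (- \<nu>)) * kk lam ^ (2 * n + 1) * bser s w) - c * Y)
        \<le> A * t powr \<nu> + 2 powr \<nu> * M * t\<^sup>2"
      using norm_triangle_ineq4 n1 n2 by (meson add_mono order_trans)
    also have "\<dots> \<le> C * t powr \<nu> + C * t\<^sup>2"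
      unfolding C_def using A(1) M(1) by (intro add_mono mult_right_mono) auto
    finally show ?thesis unfolding eq t_def by (simp add: algebra_simps)
  qed
  moreover have "C > 0" unfolding C_def using A(1) M(1) by (intro add_pos_pos) auto
  ultimately show ?thesis by blast
qed

text \<open>The exponent \<nu> - 1/2 is the one that both parities share: at integer order it
  absorbs the logarithm, at half-integer order it is weaker than what holds.\<close>

lemma hprof_asymp:
  assumes "2 * \<nu> \<in> \<nat>" and nu: "\<nu> \<ge> 3 / 2"
  shows "\<exists>C>0. \<forall>lam \<rho>. lam \<noteq> 0 \<longrightarrow> \<rho> > 0 \<longrightarrow> cmod lam * \<rho> \<le> 1 \<longrightarrow>
    cmod (of_real (\<rho> powr \<nu>) * hprof \<nu> lam \<rho> - hconst \<nu> * (1 - lam * of_real \<rho> / (4 * (of_real \<nu> - 1))))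
      \<le> C * ((cmod lam * \<rho>)\<^sup>2 + (cmod lam * \<rho>) powr (\<nu> - 1 / 2))"
  using assms(1)
proof (rule half_integer_cases)
  fix n assume n: "\<nu> = real n"
  then have "n \<ge> 2" using nu by linarith
  from hprof_nat_asymp[OF this] n show ?thesis
    by (simp add: powr_realpow cong: conj_cong imp_cong)
next
  fix n assume n: "\<nu> = real n + 1 / 2"
  then have "n \<ge> 1" using nu by linarith
  from hprof_half_asymp[OF n this] obtain C where C: "C > 0"
    "\<And>lam \<rho>. lam \<noteq> 0 \<Longrightarrow> \<rho> > 0 \<Longrightarrow> cmod lam * \<rho> \<le> 1 \<Longrightarrow>
    cmod (of_real (\<rho> powr \<nu>) * hprof \<nu> lam \<rho> - hconst \<nu> * (1 - lam * of_real \<rho> / (4 * (of_real \<nu> - 1))))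
      \<le> C * ((cmod lam * \<rho>)\<^sup>2 + (cmod lam * \<rho>) powr \<nu>)" by blast
  have le: "C * ((cmod lam * \<rho>)\<^sup>2 + (cmod lam * \<rho>) powr \<nu>) \<le> C * ((cmod lam * \<rho>)\<^sup>2 + (cmod lam * \<rho>) powr (\<nu> - 1 / 2))"
    if "lam \<noteq> 0" "\<rho> > 0" "cmod lam * \<rho> \<le> 1" for lam \<rho>
    using that C(1) by (intro mult_left_mono add_left_mono powr_mono') auto
  show ?thesis
    using C le by (meson order_trans)
qed

lemma hprof_asymp_first:
  assumes "2 * \<nu> \<in> \<nat>" and nu: "\<nu> \<ge> 3 / 2"
  shows "\<exists>C>0. \<forall>lam \<rho>. lam \<noteq> 0 \<longrightarrow> \<rho> > 0 \<longrightarrow> cmod lam * \<rho> \<le> 1 \<longrightarrow>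
    cmod (of_real (\<rho> powr \<nu>) * hprof \<nu> lam \<rho> - hconst \<nu>) \<le> C * (cmod lam * \<rho>)"
proof -
  obtain C where C: "C > 0"
    "\<And>lam \<rho>. lam \<noteq> 0 \<Longrightarrow> \<rho> > 0 \<Longrightarrow> cmod lam * \<rho> \<le> 1 \<Longrightarrow>
    cmod (of_real (\<rho> powr \<nu>) * hprof \<nu> lam \<rho> - hconst \<nu> * (1 - lam * of_real \<rho> / (4 * (of_real \<nu> - 1))))
      \<le> C * ((cmod lam * \<rho>)\<^sup>2 + (cmod lam * \<rho>) powr (\<nu> - 1 / 2))"
    using hprof_asymp[OF assms] by blast
  define D where "D = 2 * C + cmod (hconst \<nu>) / (4 * (\<nu> - 1))"
  have "cmod (of_real (\<rho> powr \<nu>) * hprof \<nu> lam \<rho> - hconst \<nu>) \<le> D * (cmod lam * \<rho>)"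
    if h: "lam \<noteq> 0" "\<rho> > 0" "cmod lam * \<rho> \<le> 1" for lam \<rho>
  proof -
    define t where "t = cmod lam * \<rho>"
    have t: "0 < t" "t \<le> 1" using h by (auto simp: t_def)
    have "t powr (\<nu> - 1 / 2) \<le> t powr 1" using t nu by (intro powr_mono') auto
    moreover have "t\<^sup>2 \<le> t" using t by (simp add: power2_eq_square mult_le_one mult_left_le)
    ultimately have "C * (t\<^sup>2 + t powr (\<nu> - 1 / 2)) \<le> C * (t + t)" using C(1) t by (intro mult_left_mono add_mono) auto
    then have b1: "cmod (of_real (\<rho> powr \<nu>) * hprof \<nu> lam \<rho> - hconst \<nu> * (1 - lam * of_real \<rho> / (4 * (of_real \<nu> - 1)))) \<le> 2 * C * t"
      using order_trans[OF C(2)[OF h, folded t_def]] by simp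
    have "cmod (4 * (complex_of_real \<nu> - 1)) = 4 * (\<nu> - 1)"
      using nu norm_of_real[of "4 * (\<nu> - 1)", where ?'a = complex] by simp
    then have b2: "cmod (hconst \<nu> * (lam * of_real \<rho> / (4 * (of_real \<nu> - 1)))) = cmod (hconst \<nu>) / (4 * (\<nu> - 1)) * t"
      using h by (simp add: norm_mult norm_divide t_def)
    have "of_real (\<rho> powr \<nu>) * hprof \<nu> lam \<rho> - hconst \<nu> =
       (of_real (\<rho> powr \<nu>) * hprof \<nu> lam \<rho> - hconst \<nu> * (1 - lam * of_real \<rho> / (4 * (of_real \<nu> - 1))))
       - hconst \<nu> * (lam * of_real \<rho> / (4 * (of_real \<nu> - 1)))" by (simp add: algebra_simps)
    then have "cmod (of_real (\<rho> powr \<nu>) * hprof \<nu> lam \<rho> - hconst \<nu>) \<le> 2 * C * t + cmod (hconst \<nu>) / (4 * (\<nu> - 1)) * t"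
      by (simp only:) (rule order_trans[OF norm_triangle_ineq4 add_mono[OF b1 eq_refl[OF b2]]])
    then show ?thesis unfolding D_def t_def by (simp add: algebra_simps)
  qed
  moreover have "D > 0" unfolding D_def using C(1) nu by (intro add_pos_nonneg) auto
  ultimately show ?thesis by blast
qed

text \<open>For t \<le> 1 and \<nu> - 1/2 \<ge> 2 the contribution of the regular part is also at
  most t^2.\<close>

lemma hprof_asymp_second:
  assumes "2 * \<nu> \<in> \<nat>" and nu: "\<nu> \<ge> 5 / 2"
  shows "\<exists>C>0. \<forall>lam \<rho>. lam \<noteq> 0 \<longrightarrow> \<rho> > 0 \<longrightarrow> cmod lam * \<rho> \<le> 1 \<longrightarrow>
    cmod (of_real (\<rho> powr \<nu>) * hprof \<nu> lam \<rho> - hconst \<nu> * (1 - lam * of_real \<rho> / (4 * (of_real \<nu> - 1))))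
      \<le> C * (cmod lam * \<rho>)\<^sup>2"
proof -
  have nu': "\<nu> \<ge> 3 / 2" using nu by simp
  obtain C where C: "C > 0"
    "\<And>lam \<rho>. lam \<noteq> 0 \<Longrightarrow> \<rho> > 0 \<Longrightarrow> cmod lam * \<rho> \<le> 1 \<Longrightarrow>
    cmod (of_real (\<rho> powr \<nu>) * hprof \<nu> lam \<rho> - hconst \<nu> * (1 - lam * of_real \<rho> / (4 * (of_real \<nu> - 1))))
      \<le> C * ((cmod lam * \<rho>)\<^sup>2 + (cmod lam * \<rho>) powr (\<nu> - 1 / 2))"
    using hprof_asymp[OF assms(1) nu'] by blast
  have le: "C * ((cmod lam * \<rho>)\<^sup>2 + (cmod lam * \<rho>) powr (\<nu> - 1 / 2)) \<le> 2 * C * (cmod lam * \<rho>)\<^sup>2"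
    if h: "lam \<noteq> 0" "\<rho> > 0" "cmod lam * \<rho> \<le> 1" for lam \<rho>
  proof -
    have "(cmod lam * \<rho>) powr (\<nu> - 1 / 2) \<le> (cmod lam * \<rho>) powr real 2" using h nu by (intro powr_mono') auto
    also have "\<dots> = (cmod lam * \<rho>)\<^sup>2" using h by (intro powr_realpow) auto
    finally have "C * ((cmod lam * \<rho>)\<^sup>2 + (cmod lam * \<rho>) powr (\<nu> - 1 / 2)) \<le> C * ((cmod lam * \<rho>)\<^sup>2 + (cmod lam * \<rho>)\<^sup>2)"
      using C(1) by (intro mult_left_mono) auto
    then show ?thesis by simp
  qed
  show ?thesis
    by (intro exI[of _ "2 * C"] conjI allI impI order_trans[OF C(2) le]) (use C(1) in simp_all)
qed

subsection \<open>Derivatives of radial functions and the Stokes matrix\<close>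

text \<open>The part of the profile that is independent of \<open>lam\<close>; up to
  \<open>gconst\<close> it is G(x;0). It obeys the same raising rule as \<open>hprof\<close>, hence
  so does the difference \<open>hdiff\<close>.\<close>

definition hlead :: "real \<Rightarrow> real \<Rightarrow> complex" where
  "hlead \<nu> \<rho> = hconst \<nu> * of_real (\<rho> powr (- \<nu>))"

definition hdiff :: "real \<Rightarrow> complex \<Rightarrow> real \<Rightarrow> complex" where
  "hdiff \<nu> lam \<rho> = hprof \<nu> lam \<rho> - hlead \<nu> \<rho>"

lemma hlead_deriv:
  assumes "\<rho> > 0" "\<nu> > 0"
  shows "(hlead \<nu> has_vector_derivative - hlead (\<nu> + 1) \<rho> / 2) (at \<rho>)"
proof -
  have "((\<lambda>r. r powr (- \<nu>)) has_real_derivative (- \<nu> * \<rho> powr (- \<nu> - 1))) (at \<rho>)"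
    using assms by (auto intro!: derivative_eq_intros)
  then have "((\<lambda>r. complex_of_real (r powr (- \<nu>))) has_vector_derivative of_real (- \<nu> * \<rho> powr (- \<nu> - 1))) (at \<rho>)"
    by (intro has_vector_derivative_of_real) (simp add: has_real_derivative_iff_has_vector_derivative)
  then have "(hlead \<nu> has_vector_derivative hconst \<nu> * of_real (- \<nu> * \<rho> powr (- \<nu> - 1))) (at \<rho>)"
    unfolding hlead_def[abs_def] by (rule has_vector_derivative_mult_right)
  moreover have "hconst \<nu> * of_real (- \<nu> * \<rho> powr (- \<nu> - 1)) = - hlead (\<nu> + 1) \<rho> / 2"
    unfolding hlead_def hconst_plus1[OF assms(2)] by simp
  ultimately show ?thesis by (simp only:)
qed

lemma hdiff_deriv:
  assumes "lam \<noteq> 0" "\<rho> > 0" "2 * \<nu> \<in> \<nat>" "\<nu> > 0"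
  shows "(hdiff \<nu> lam has_vector_derivative - hdiff (\<nu> + 1) lam \<rho> / 2) (at \<rho>)"
proof -
  have "(hdiff \<nu> lam has_vector_derivative - hprof (\<nu> + 1) lam \<rho> / 2 - (- hlead (\<nu> + 1) \<rho> / 2)) (at \<rho>)"
    unfolding hdiff_def[abs_def] by (intro has_vector_derivative_diff hprof_deriv hlead_deriv assms)
  then show ?thesis by (simp add: hdiff_def diff_divide_distrib)
qed

lemma hdiff_bound:
  assumes "2 * \<nu> \<in> \<nat>" "\<nu> \<ge> 3 / 2"
  shows "\<exists>C>0. \<forall>lam \<rho>. lam \<noteq> 0 \<longrightarrow> \<rho> > 0 \<longrightarrow> cmod lam * \<rho> \<le> 1 \<longrightarrow>
    cmod (hdiff \<nu> lam \<rho>) \<le> C * cmod lam * \<rho> powr (1 - \<nu>)"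
proof -
  obtain C where C: "C > 0"
    "\<And>lam \<rho>. lam \<noteq> 0 \<Longrightarrow> \<rho> > 0 \<Longrightarrow> cmod lam * \<rho> \<le> 1 \<Longrightarrow>
      cmod (of_real (\<rho> powr \<nu>) * hprof \<nu> lam \<rho> - hconst \<nu>) \<le> C * (cmod lam * \<rho>)"
    using hprof_asymp_first[OF assms] by blast
  have "cmod (hdiff \<nu> lam \<rho>) \<le> C * cmod lam * \<rho> powr (1 - \<nu>)"
    if h: "lam \<noteq> 0" "\<rho> > 0" "cmod lam * \<rho> \<le> 1" for lam \<rho>
  proof -
    have rr: "complex_of_real (\<rho> powr (- \<nu>)) * of_real (\<rho> powr \<nu>) = 1"
      using h(2) by (simp add: powr_minus flip: of_real_mult)
    have "hdiff \<nu> lam \<rho> = (of_real (\<rho> powr (- \<nu>)) * of_real (\<rho> powr \<nu>)) * hprof \<nu> lam \<rho> - hlead \<nu> \<rho>"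
      unfolding rr hdiff_def by simp
    also have "\<dots> = of_real (\<rho> powr (- \<nu>)) * (of_real (\<rho> powr \<nu>) * hprof \<nu> lam \<rho> - hconst \<nu>)"
      by (simp add: hlead_def algebra_simps)
    finally have "cmod (hdiff \<nu> lam \<rho>) = \<rho> powr (- \<nu>) * cmod (of_real (\<rho> powr \<nu>) * hprof \<nu> lam \<rho> - hconst \<nu>)"
      by (simp add: norm_mult)
    also have "\<dots> \<le> \<rho> powr (- \<nu>) * (C * (cmod lam * \<rho>))"
      by (intro mult_left_mono C(2) h) auto
    also have "\<dots> = C * cmod lam * \<rho> powr (1 - \<nu>)"
      using h(2) by (simp add: powr_diff powr_minus field_simps)
    finally show ?thesis .
  qed
  with C(1) show ?thesis by blast
qed

text \<open>After division by \<open>lam\<close> the second term of the expansion at order \<nu> + 1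
  equals -\<open>hlead \<nu> \<rho>\<close> / 2, so the sum retains only the remainder. The Stokes
  matrix and G together supply this half.\<close>

lemma hdiff_second_bound:
  assumes "2 * \<nu> \<in> \<nat>" "\<nu> \<ge> 3 / 2"
  shows "\<exists>C>0. \<forall>lam \<rho>. lam \<noteq> 0 \<longrightarrow> \<rho> > 0 \<longrightarrow> cmod lam * \<rho> \<le> 1 \<longrightarrow>
    cmod (hdiff (\<nu> + 1) lam \<rho> / lam + hlead \<nu> \<rho> / 2) \<le> C * cmod lam * \<rho> powr (1 - \<nu>)"
proof -
  define \<mu> where "\<mu> = \<nu> + 1"
  have m: "2 * \<mu> \<in> \<nat>" "\<mu> \<ge> 5 / 2"
  proof -
    have "2 * \<nu> + of_nat 2 \<in> \<nat>" by (intro Nats_add assms(1) of_nat_in_Nats)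
    then show "2 * \<mu> \<in> \<nat>" by (simp add: \<mu>_def algebra_simps)
  qed (use assms in \<open>simp add: \<mu>_def\<close>)
  obtain C where C: "C > 0"
    "\<And>lam \<rho>. lam \<noteq> 0 \<Longrightarrow> \<rho> > 0 \<Longrightarrow> cmod lam * \<rho> \<le> 1 \<Longrightarrow>
      cmod (of_real (\<rho> powr \<mu>) * hprof \<mu> lam \<rho> - hconst \<mu> * (1 - lam * of_real \<rho> / (4 * (of_real \<mu> - 1))))
      \<le> C * (cmod lam * \<rho>)\<^sup>2"
    using hprof_asymp_second[OF m] by blast
  have "cmod (hdiff \<mu> lam \<rho> / lam + hlead \<nu> \<rho> / 2) \<le> C * cmod lam * \<rho> powr (1 - \<nu>)"
    if h: "lam \<noteq> 0" "\<rho> > 0" "cmod lam * \<rho> \<le> 1" for lam \<rho>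
  proof -
    define E where "E = of_real (\<rho> powr \<mu>) * hprof \<mu> lam \<rho> - hconst \<mu> * (1 - lam * of_real \<rho> / (4 * (of_real \<mu> - 1)))"
    have rr: "complex_of_real (\<rho> powr (- \<mu>)) * of_real (\<rho> powr \<mu>) = 1"
      using h(2) by (simp add: powr_minus flip: of_real_mult)
    have r1: "complex_of_real (\<rho> powr (- \<nu>)) = of_real (\<rho> powr (- \<mu>)) * of_real \<rho>"
      using h(2) unfolding \<mu>_def of_real_mult[symmetric] by (simp add: powr_diff powr_minus field_simps)
    have nu: "complex_of_real \<nu> \<noteq> 0" using assms by auto
    \<comment> \<open>The denominator 4 (\<mu> - 1) = 4 \<nu> meets the factor 2 \<nu> of
      \<open>hconst_plus1\<close>; this is where the 1/2 comes from.\<close>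
    have c: "hconst \<mu> * (lam * of_real \<rho> / (4 * (of_real \<mu> - 1))) = lam * of_real \<rho> * hconst \<nu> / 2"
      unfolding \<mu>_def using hconst_plus1[of \<nu>] assms nu by simp
    have "hprof \<mu> lam \<rho> = (of_real (\<rho> powr (- \<mu>)) * of_real (\<rho> powr \<mu>)) * hprof \<mu> lam \<rho>"
      unfolding rr by simp
    also have "\<dots> = of_real (\<rho> powr (- \<mu>)) * (E + hconst \<mu> - hconst \<mu> * (lam * of_real \<rho> / (4 * (of_real \<mu> - 1))))"
      unfolding E_def by (simp add: algebra_simps)
    finally have "hdiff \<mu> lam \<rho> = of_real (\<rho> powr (- \<mu>)) * (E - lam * of_real \<rho> * hconst \<nu> / 2)"
      unfolding c hdiff_def hlead_def by (simp add: algebra_simps)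
    then have "hdiff \<mu> lam \<rho> / lam + hlead \<nu> \<rho> / 2 = of_real (\<rho> powr (- \<mu>)) * E / lam"
      unfolding hlead_def r1 using h(1) by (simp add: field_simps)
    then have "cmod (hdiff \<mu> lam \<rho> / lam + hlead \<nu> \<rho> / 2) = \<rho> powr (- \<mu>) * cmod E / cmod lam"
      by (simp add: norm_mult norm_divide)
    also have "\<dots> \<le> \<rho> powr (- \<mu>) * (C * (cmod lam * \<rho>)\<^sup>2) / cmod lam"
      unfolding E_def by (intro divide_right_mono mult_left_mono C(2) h) auto
    also have "\<dots> = C * cmod lam * (\<rho> powr (- \<mu>) * \<rho> powr 2)"
      using h by (simp add: power2_eq_square)
    also have "\<rho> powr (- \<mu>) * \<rho> powr 2 = \<rho> powr (1 - \<nu>)"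
      unfolding powr_add[symmetric] \<mu>_def by simp
    finally show ?thesis .
  qed
  with C(1) show ?thesis unfolding \<mu>_def by blast
qed

section \<open>Coordinate derivatives as a relation, for use with derivative rules\<close>

definition has_pd :: "(real ^ 'n \<Rightarrow> complex) \<Rightarrow> 'n \<Rightarrow> real ^ 'n \<Rightarrow> complex \<Rightarrow> bool" where
  "has_pd f \<alpha> x D \<longleftrightarrow> ((\<lambda>t. f (x + t *\<^sub>R axis \<alpha> 1)) has_vector_derivative D) (at 0)"

lemma pd_eqI: "has_pd f \<alpha> x D \<Longrightarrow> pd f \<alpha> x = D"
  unfolding has_pd_def pd_def by (rule vector_derivative_at)

lemma has_pd_add: "has_pd f \<alpha> x D \<Longrightarrow> has_pd g \<alpha> x E \<Longrightarrow> has_pd (\<lambda>y. f y + g y) \<alpha> x (D + E)"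
  unfolding has_pd_def by (rule has_vector_derivative_add)

lemma has_pd_diff: "has_pd f \<alpha> x D \<Longrightarrow> has_pd g \<alpha> x E \<Longrightarrow> has_pd (\<lambda>y. f y - g y) \<alpha> x (D - E)"
  unfolding has_pd_def by (rule has_vector_derivative_diff)

lemma has_pd_cmult: "has_pd f \<alpha> x D \<Longrightarrow> has_pd (\<lambda>y. c * f y) \<alpha> x (c * D)"
  unfolding has_pd_def by (rule has_vector_derivative_mult_right)

lemma has_pd_mult:
  "has_pd f \<alpha> x D \<Longrightarrow> has_pd g \<alpha> x E \<Longrightarrow> has_pd (\<lambda>y. f y * g y) \<alpha> x (f x * E + D * g x)"
  unfolding has_pd_def by (drule (1) has_vector_derivative_mult) simp

lemma has_pd_coord:
  "has_pd (\<lambda>y :: real ^ 'n. of_real (y $ \<beta>)) \<alpha> x (if \<alpha> = \<beta> then 1 else 0)"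
proof -
  have "((\<lambda>t. (x + t *\<^sub>R axis \<alpha> 1) $ \<beta>) has_real_derivative (if \<alpha> = \<beta> then 1 else 0)) (at 0)"
    by (auto intro!: derivative_eq_intros simp: axis_def)
  then have "((\<lambda>t. complex_of_real ((x + t *\<^sub>R axis \<alpha> 1) $ \<beta>)) has_vector_derivative
      of_real (if \<alpha> = \<beta> then 1 else 0)) (at 0)"
    by (intro has_vector_derivative_of_real) (simp add: has_real_derivative_iff_has_vector_derivative)
  then show ?thesis unfolding has_pd_def by (simp split: if_splits)
qed

text \<open>The derivative of y \<bullet> y is 2 y_\<alpha>. Writing the outer derivative as -D/2
  cancels the 2 and fits the raising rule, with D the profile of the next order.\<close>

lemma has_pd_radial:
  fixes x :: "real ^ 'n::finite"
  assumes "(\<psi> has_vector_derivative - D / 2) (at (x \<bullet> x))"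
  shows "has_pd (\<lambda>y. \<psi> (y \<bullet> y)) \<alpha> x (- (of_real (x $ \<alpha>) * D))"
proof -
  define q where "q = (\<lambda>t. (x + t *\<^sub>R axis \<alpha> 1) \<bullet> (x + t *\<^sub>R axis \<alpha> 1))"
  have "q = (\<lambda>t. x \<bullet> x + t * (2 * x $ \<alpha>) + t * t)"
    by (simp add: q_def fun_eq_iff inner_add_left inner_add_right inner_axis inner_axis' inner_commute algebra_simps)
  then have "(q has_real_derivative 2 * x $ \<alpha>) (at 0)"
    by (auto intro!: derivative_eq_intros)
  then have "(q has_vector_derivative 2 * x $ \<alpha>) (at 0)"
    by (simp add: has_real_derivative_iff_has_vector_derivative)
  moreover have "q 0 = x \<bullet> x" by (simp add: q_def)
  ultimately have "((\<psi> \<circ> q) has_vector_derivative (2 * x $ \<alpha>) *\<^sub>R (- D / 2)) (at 0)"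
    using assms by (intro vector_diff_chain_at) auto
  then show ?thesis by (simp add: has_pd_def o_def q_def scaleR_conv_of_real)
qed

text \<open>The radial formulas hold only away from the origin, but a short coordinate segment
  through x \<noteq> 0 avoids it. This is needed in particular to differentiate a formula for
  \<open>pd\<close> once more.\<close>

lemma has_pd_transform:
  fixes x :: "real ^ 'n::finite"
  assumes "has_pd f \<alpha> x D" "x \<noteq> 0" "\<And>y. y \<noteq> 0 \<Longrightarrow> f y = g y"
  shows "has_pd g \<alpha> x D"
proof -
  have "isCont (\<lambda>t. x + t *\<^sub>R axis \<alpha> 1) 0" by (intro continuous_intros)
  then have "((\<lambda>t. x + t *\<^sub>R axis \<alpha> 1) \<longlongrightarrow> x) (at 0)" by (simp add: isCont_def)
  then have ev: "eventually (\<lambda>t. x + t *\<^sub>R axis \<alpha> 1 \<noteq> 0) (at 0)"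
    using assms(2) by (rule tendsto_imp_eventually_ne)
  then obtain d where d: "d > 0" "\<And>t. t \<noteq> 0 \<Longrightarrow> dist t 0 < d \<Longrightarrow> x + t *\<^sub>R axis \<alpha> 1 \<noteq> 0"
    unfolding eventually_at by auto
  have "f (x + t *\<^sub>R axis \<alpha> 1) = g (x + t *\<^sub>R axis \<alpha> 1)" if "t \<in> ball 0 d" for t
    using d(2)[of t] that assms(2,3) by (cases "t = 0") (auto simp: dist_commute)
  then show ?thesis unfolding has_pd_def
    by (intro has_vector_derivative_transform_within_open[OF assms(1)[unfolded has_pd_def], of "ball 0 d"])
       (use d(1) in simp_all)
qed

section \<open>Matching the normalising constants of G, G(x;0) and the Stokes matrix\<close>

definition gconst :: "real \<Rightarrow> complex" where
  "gconst \<nu> = \<i> / (4 * of_real ((2 * pi) powr \<nu>))"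

lemma norm_powr_inner: "x \<noteq> 0 \<Longrightarrow> norm x powr (2 * a) = (x \<bullet> x) powr a"
  for x :: "'a::real_inner"
  by (simp add: power2_norm_eq_inner[symmetric] powr_powr[symmetric])

lemma G_eq:
  fixes x :: "real ^ 'n::finite"
  assumes "x \<noteq> 0" and nu: "\<nu> = real CARD('n) / 2 - 1"
  shows "G TYPE('n) x lam = gconst \<nu> * hprof \<nu> lam (x \<bullet> x)"
proof -
  have s: "sqrt (x \<bullet> x) = norm x" by (simp add: norm_eq_sqrt_inner)
  have 1: "norm x powr (2 - real CARD('n)) = (x \<bullet> x) powr (- \<nu>)"
    using norm_powr_inner[OF assms(1), of "- \<nu>"] by (simp add: nu algebra_simps)
  have 2: "(real CARD('n) - 2) / 2 = \<nu>" "real CARD('n) / 2 - 1 = \<nu>" by (simp_all add: nu diff_divide_distrib)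
  show ?thesis unfolding G_def Let_def 1 2 gconst_def hprof_def s by (simp only: mult.assoc)
qed

text \<open>The value is 1 / ((d - 2) \<omega>_d), the normalisation of G(x;0): this is why
  subtracting G(x;0) removes precisely the leading term of G.\<close>

lemma gconst_hconst:
  assumes "\<nu> > 0"
  shows "gconst \<nu> * hconst \<nu> = of_real (Gamma \<nu> / (4 * pi powr (\<nu> + 1)))"
proof -
  have "gconst \<nu> * hconst \<nu> = of_real (2 powr \<nu> * Gamma \<nu> / pi / (4 * (2 * pi) powr \<nu>))"
    by (simp add: gconst_def hconst_def)
  also have "2 powr \<nu> * Gamma \<nu> / pi / (4 * (2 * pi) powr \<nu>) = Gamma \<nu> / (4 * pi powr (\<nu> + 1))"
    by (simp add: powr_mult powr_add)
  finally show ?thesis .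
qed

lemma omega_eq:
  assumes "\<nu> = real d / 2 - 1" "\<nu> > 0"
  shows "omega d = 2 * pi powr (\<nu> + 1) / (\<nu> * Gamma \<nu>)"
proof -
  have "real d / 2 = \<nu> + 1" using assms by simp
  moreover have "Gamma (\<nu> + 1) = \<nu> * Gamma \<nu>" using assms(2) by (intro Gamma_plus1) (auto simp: nonpos_Ints_def)
  ultimately show ?thesis unfolding omega_def by (simp only:)
qed

lemma G0_eq:
  fixes x :: "real ^ 'n::finite"
  assumes "x \<noteq> 0" and nu: "\<nu> = real CARD('n) / 2 - 1" "\<nu> > 0"
  shows "G0 TYPE('n) x = gconst \<nu> * hlead \<nu> (x \<bullet> x)"
proof -
  have 1: "norm x powr (2 - real CARD('n)) = (x \<bullet> x) powr (- \<nu>)"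
    using norm_powr_inner[OF assms(1), of "- \<nu>"] by (simp add: nu algebra_simps)
  have 2: "real CARD('n) - 2 = 2 * \<nu>" by (simp add: nu)
  have 3: "1 / (2 * \<nu> * omega CARD('n)) = Gamma \<nu> / (4 * pi powr (\<nu> + 1))"
    unfolding omega_eq[OF nu] using nu(2) by simp
  show ?thesis unfolding G0_def Let_def 1 2 3 hlead_def mult.assoc[symmetric] gconst_hconst[OF nu(2)] by simp
qed

text \<open>Expresses the Stokes matrix in the leading profiles of orders \<nu> and \<nu> + 1, so
  that it is differentiated by the same rules as G and can be compared order by order.\<close>

lemma Gamma_stokes_eq:
  fixes x :: "real ^ 'n::finite"
  assumes "x \<noteq> 0" and nu: "\<nu> = real CARD('n) / 2 - 1" "\<nu> > 0"
  shows "Gamma_stokes x \<alpha> \<beta> = gconst \<nu> *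
     ((if \<alpha> = \<beta> then 1 else 0) * hlead \<nu> (x \<bullet> x) / 2
      + of_real (x $ \<alpha>) * of_real (x $ \<beta>) * hlead (\<nu> + 1) (x \<bullet> x) / 2)"
proof -
  define K where "K = Gamma \<nu> / (4 * pi powr (\<nu> + 1))"
  have n3: "real CARD('n) > 2" using nu by simp
  have c: "real (CARD('n) - 2) = real CARD('n) - 2" using n3 by (simp add: of_nat_diff)
  have 0: "norm x > 0" using assms by simp
  have p1: "norm x ^ (CARD('n) - 2) = (x \<bullet> x) powr \<nu>"
    unfolding powr_realpow[OF 0, symmetric] c using norm_powr_inner[OF assms(1), of \<nu>] by (simp add: nu(1) algebra_simps)
  have p2: "norm x ^ CARD('n) = (x \<bullet> x) powr (\<nu> + 1)"
    unfolding powr_realpow[OF 0, symmetric] using norm_powr_inner[OF assms(1), of "\<nu> + 1"] by (simp add: nu(1) algebra_simps)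
  have 2: "real CARD('n) - 2 = 2 * \<nu>" by (simp add: nu)
  have 3: "1 / (2 * omega CARD('n)) = \<nu> * K"
    unfolding omega_eq[OF nu] K_def using nu(2) by simp
  have k1: "gconst \<nu> * hlead \<nu> (x \<bullet> x) = of_real (K * (x \<bullet> x) powr (- \<nu>))"
    unfolding hlead_def mult.assoc[symmetric] gconst_hconst[OF nu(2)] K_def by simp
  have k2: "gconst \<nu> * hlead (\<nu> + 1) (x \<bullet> x) = of_real (2 * \<nu> * K * (x \<bullet> x) powr (- (\<nu> + 1)))"
  proof -
    have "gconst \<nu> * hlead (\<nu> + 1) (x \<bullet> x) = 2 * of_real \<nu> * (gconst \<nu> * hconst \<nu>) * of_real ((x \<bullet> x) powr (- (\<nu> + 1)))"
      unfolding hlead_def hconst_plus1[OF nu(2)] by (simp only: mult_ac)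
    then show ?thesis unfolding gconst_hconst[OF nu(2)] K_def by simp
  qed
  define \<delta> where "\<delta> = (if \<alpha> = \<beta> then 1 else (0::real))"
  have d: "(if \<alpha> = \<beta> then 1 else 0) = complex_of_real \<delta>" by (simp add: \<delta>_def)
  have "gconst \<nu> * (of_real \<delta> * hlead \<nu> (x \<bullet> x) / 2
      + of_real (x $ \<alpha>) * of_real (x $ \<beta>) * hlead (\<nu> + 1) (x \<bullet> x) / 2)
    = of_real \<delta> * (gconst \<nu> * hlead \<nu> (x \<bullet> x)) / 2
      + of_real (x $ \<alpha>) * of_real (x $ \<beta>) * (gconst \<nu> * hlead (\<nu> + 1) (x \<bullet> x)) / 2"
    by (simp add: algebra_simps)
  also have "\<dots> = of_real (\<nu> * K * (\<delta> / (2 * \<nu>) * (x \<bullet> x) powr (- \<nu>)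
      + x $ \<alpha> * x $ \<beta> * (x \<bullet> x) powr (- (\<nu> + 1))))"
    unfolding k1 k2 using nu(2) by (simp add: distrib_left)
  also have "\<dots> = Gamma_stokes x \<alpha> \<beta>"
    unfolding Gamma_stokes_def p1 p2 2 3 \<delta>_def[symmetric] by (simp only: powr_minus divide_inverse inverse_mult_distrib mult_ac)
  finally show ?thesis unfolding d ..
qed

subsection \<open>The gradient estimate\<close>

text \<open>The right-hand side is grouped so that each \<open>hdiff\<close> divided by
  \<open>lam\<close> stands next to the half \<open>hlead\<close> that cancels its second expansion
  term.\<close>

lemma grad_entry:
  fixes x :: "real ^ 'n::finite"
  assumes x: "x \<noteq> 0" and lam: "lam \<noteq> 0" and nu: "\<nu> = real CARD('n) / 2 - 1" "\<nu> > 0"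
  defines "\<rho> \<equiv> x \<bullet> x"
  defines "\<delta> \<equiv> (\<lambda>i j :: 'n. if i = j then 1 else 0 :: complex)"
  defines "X \<equiv> (\<lambda>i. complex_of_real (x $ i))"
  shows "pd (\<lambda>y. Gamma_res lam y \<alpha> \<beta> - Gamma_stokes y \<alpha> \<beta>) \<gamma> x = gconst \<nu> *
    (- \<delta> \<alpha> \<beta> * X \<gamma> * hdiff (\<nu> + 1) lam \<rho>
     - (\<delta> \<alpha> \<beta> * X \<gamma> + \<delta> \<gamma> \<alpha> * X \<beta> + \<delta> \<gamma> \<beta> * X \<alpha>) * (hdiff (\<nu> + 2) lam \<rho> / lam + hlead (\<nu> + 1) \<rho> / 2)
     + X \<alpha> * X \<beta> * X \<gamma> * (hdiff (\<nu> + 3) lam \<rho> / lam + hlead (\<nu> + 2) \<rho> / 2))"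
proof -
  have int: "2 * (\<nu> + real j) \<in> \<nat>" for j
  proof -
    have "2 * (\<nu> + real j) = real (CARD('n) - 2 + 2 * j)"
      using nu by (simp add: of_nat_diff algebra_simps)
    then show ?thesis by (metis of_nat_in_Nats)
  qed
  have pos: "y \<bullet> y > 0" if "y \<noteq> 0" for y :: "real ^ 'n" using that by simp
  have Hd: "has_pd (\<lambda>y. hdiff (\<nu> + real j) lam (y \<bullet> y)) i y (- (of_real (y $ i) * hdiff (\<nu> + real (Suc j)) lam (y \<bullet> y)))"
    if "y \<noteq> 0" for i j and y :: "real ^ 'n"
    using hdiff_deriv[OF lam pos[OF that] int[of j]] nu(2) by (intro has_pd_radial) (simp add: add_ac)
  have Hp: "has_pd (\<lambda>y. hprof \<nu> lam (y \<bullet> y)) i y (- (of_real (y $ i) * hprof (\<nu> + 1) lam (y \<bullet> y)))"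
    if "y \<noteq> 0" for i and y :: "real ^ 'n"
    using hprof_deriv[OF lam pos[OF that], of \<nu>] int[of 0] by (intro has_pd_radial) simp
  have Hl: "has_pd (\<lambda>y. hlead (\<nu> + real j) (y \<bullet> y)) i y (- (of_real (y $ i) * hlead (\<nu> + real (Suc j)) (y \<bullet> y)))"
    if "y \<noteq> 0" for i j and y :: "real ^ 'n"
    using hlead_deriv[OF pos[OF that], of "\<nu> + real j"] nu(2) by (intro has_pd_radial) (simp add: add_ac)
  note Hd0 = Hd[where j = 0, simplified] and Hd1 = Hd[where j = 1, simplified] and Hd2 = Hd[where j = 2, simplified]
  note Hl0 = Hl[where j = 0, simplified] and Hl1 = Hl[where j = 1, simplified]
  have u: "G TYPE('n) y lam - G0 TYPE('n) y = gconst \<nu> * hdiff \<nu> lam (y \<bullet> y)" if "y \<noteq> 0" for y :: "real ^ 'n"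
    unfolding G_eq[OF that nu(1)] G0_eq[OF that nu] hdiff_def by (simp add: right_diff_distrib)
  have pu: "pd (\<lambda>y. G TYPE('n) y lam - G0 TYPE('n) y) i y = gconst \<nu> * (- (of_real (y $ i) * hdiff (\<nu> + 1) lam (y \<bullet> y)))"
    if "y \<noteq> 0" for i and y :: "real ^ 'n"
    by (rule pd_eqI, rule has_pd_transform[OF has_pd_cmult[OF Hd0[OF that]] that]) (use u in auto)
  have ppu: "pd (pd (\<lambda>y. G TYPE('n) y lam - G0 TYPE('n) y) j) i y =
      gconst \<nu> * (- (of_real (y $ j) * (- (of_real (y $ i) * hdiff (\<nu> + 2) lam (y \<bullet> y))) + \<delta> i j * hdiff (\<nu> + 1) lam (y \<bullet> y)))"
    if "y \<noteq> 0" for i j and y :: "real ^ 'n"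
  proof (rule pd_eqI, rule has_pd_transform[OF _ that])
    have "has_pd (\<lambda>y. of_real (y $ j) * hdiff (\<nu> + 1) lam (y \<bullet> y)) i y
       (of_real (y $ j) * (- (of_real (y $ i) * hdiff (\<nu> + 2) lam (y \<bullet> y))) + \<delta> i j * hdiff (\<nu> + 1) lam (y \<bullet> y))"
      unfolding \<delta>_def by (rule has_pd_mult[OF has_pd_coord Hd1[OF that]])
    from has_pd_cmult[OF this, of "- gconst \<nu>"]
    show "has_pd (\<lambda>y. - gconst \<nu> * (of_real (y $ j) * hdiff (\<nu> + 1) lam (y \<bullet> y))) i y
      (gconst \<nu> * (- (of_real (y $ j) * (- (of_real (y $ i) * hdiff (\<nu> + 2) lam (y \<bullet> y))) + \<delta> i j * hdiff (\<nu> + 1) lam (y \<bullet> y))))"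
      by (simp only: mult_minus_left mult_minus_right)
  qed (simp add: pu)
  define F where "F = (\<lambda>y :: real ^ 'n. gconst \<nu> * (\<delta> \<alpha> \<beta> * hprof \<nu> lam (y \<bullet> y)
     - (1 / lam) * (of_real (y $ \<beta>) * (of_real (y $ \<alpha>) * hdiff (\<nu> + 2) lam (y \<bullet> y)) - \<delta> \<alpha> \<beta> * hdiff (\<nu> + 1) lam (y \<bullet> y))
     - 1 / 2 * (\<delta> \<alpha> \<beta> * hlead \<nu> (y \<bullet> y) + of_real (y $ \<alpha>) * (of_real (y $ \<beta>) * hlead (\<nu> + 1) (y \<bullet> y)))))"
  have F: "F y = Gamma_res lam y \<alpha> \<beta> - Gamma_stokes y \<alpha> \<beta>" if "y \<noteq> 0" for y
    unfolding Gamma_res_def ppu[OF that] G_eq[OF that nu(1)] Gamma_stokes_eq[OF that nu] F_def \<delta>_def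
    by (simp add: algebra_simps add_divide_distrib)
  \<comment> \<open>Left in the unsimplified shape in which the sum and product rules deliver the
    derivative of F.\<close>
  define D where "D = gconst \<nu> * (\<delta> \<alpha> \<beta> * (- (X \<gamma> * hprof (\<nu> + 1) lam \<rho>))
     - (1 / lam) * ((X \<beta> * (X \<alpha> * (- (X \<gamma> * hdiff (\<nu> + 3) lam \<rho>)) + \<delta> \<gamma> \<alpha> * hdiff (\<nu> + 2) lam \<rho>) + \<delta> \<gamma> \<beta> * (X \<alpha> * hdiff (\<nu> + 2) lam \<rho>))
          - \<delta> \<alpha> \<beta> * (- (X \<gamma> * hdiff (\<nu> + 2) lam \<rho>)))
     - 1 / 2 * (\<delta> \<alpha> \<beta> * (- (X \<gamma> * hlead (\<nu> + 1) \<rho>))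
          + (X \<alpha> * (X \<beta> * (- (X \<gamma> * hlead (\<nu> + 2) \<rho>)) + \<delta> \<gamma> \<beta> * hlead (\<nu> + 1) \<rho>) + \<delta> \<gamma> \<alpha> * (X \<beta> * hlead (\<nu> + 1) \<rho>))))"
  have FD: "has_pd F \<gamma> x D"
    unfolding F_def D_def \<delta>_def X_def \<rho>_def
    by (intro has_pd_cmult has_pd_diff has_pd_add has_pd_mult has_pd_coord Hp[OF x] Hd1[OF x] Hd2[OF x] Hl0[OF x] Hl1[OF x])
  have eq: "pd (\<lambda>y. Gamma_res lam y \<alpha> \<beta> - Gamma_stokes y \<alpha> \<beta>) \<gamma> x = D"
    by (rule pd_eqI[OF has_pd_transform[OF FD x F]])
  \<comment> \<open>G contributes a full \<open>hlead (\<nu> + 1)\<close> and the Stokes matrix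
    takes away half of it; the other half completes the group with
    \<open>hdiff (\<nu> + 2)\<close>.\<close>
  have hp: "hprof (\<nu> + 1) lam \<rho> = hdiff (\<nu> + 1) lam \<rho> + hlead (\<nu> + 1) \<rho>"
    by (simp add: hdiff_def)
  show ?thesis unfolding eq D_def hp using lam by (simp add: field_simps)
qed

text \<open>Every term scales alike: one coordinate against \<rho>^(-\<nu>), or three against
  \<rho>^(-\<nu> - 1), both give r^(1 - 2 \<nu>) = r^(3 - d).\<close>

lemma grad_entry_bound:
  fixes \<nu> :: real
  assumes nu: "\<nu> = real CARD('n::finite) / 2 - 1" "\<nu> \<ge> 1 / 2"
  shows "\<exists>C>0. \<forall>lam. \<forall>x :: real ^ 'n. \<forall>\<alpha> \<beta> \<gamma>. lam \<noteq> 0 \<longrightarrow> x \<noteq> 0 \<longrightarrow> cmod lam * (norm x)\<^sup>2 \<le> 1 \<longrightarrow>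
    cmod (pd (\<lambda>y. Gamma_res lam y \<alpha> \<beta> - Gamma_stokes y \<alpha> \<beta>) \<gamma> x) \<le> C * cmod lam * norm x powr (3 - real CARD('n))"
proof -
  have int: "2 * (\<nu> + real j) \<in> \<nat>" for j
  proof -
    have "2 * (\<nu> + real j) = real (CARD('n) - 2 + 2 * j)"
      using nu by (simp add: of_nat_diff algebra_simps)
    then show ?thesis by (metis of_nat_in_Nats)
  qed
  have "2 * (\<nu> + 1) \<in> \<nat>" "\<nu> + 1 \<ge> 3 / 2" "2 * (\<nu> + 2) \<in> \<nat>" "\<nu> + 2 \<ge> 3 / 2"
    using int[of 1] int[of 2] nu(2) by simp_all
  note hyp = this
  obtain C1 where C1: "C1 > 0"
    and b1: "\<And>lam \<rho>. lam \<noteq> 0 \<Longrightarrow> \<rho> > 0 \<Longrightarrow> cmod lam * \<rho> \<le> 1 \<Longrightarrow>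
       cmod (hdiff (\<nu> + 1) lam \<rho>) \<le> C1 * cmod lam * \<rho> powr (1 - (\<nu> + 1))"
    using hdiff_bound[OF hyp(1,2)] by blast
  obtain C2 where C2: "C2 > 0"
    and b2: "\<And>lam \<rho>. lam \<noteq> 0 \<Longrightarrow> \<rho> > 0 \<Longrightarrow> cmod lam * \<rho> \<le> 1 \<Longrightarrow>
       cmod (hdiff (\<nu> + 1 + 1) lam \<rho> / lam + hlead (\<nu> + 1) \<rho> / 2) \<le> C2 * cmod lam * \<rho> powr (1 - (\<nu> + 1))"
    using hdiff_second_bound[OF hyp(1,2)] by blast
  obtain C3 where C3: "C3 > 0"
    and b3: "\<And>lam \<rho>. lam \<noteq> 0 \<Longrightarrow> \<rho> > 0 \<Longrightarrow> cmod lam * \<rho> \<le> 1 \<Longrightarrow>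
       cmod (hdiff (\<nu> + 2 + 1) lam \<rho> / lam + hlead (\<nu> + 2) \<rho> / 2) \<le> C3 * cmod lam * \<rho> powr (1 - (\<nu> + 2))"
    using hdiff_second_bound[OF hyp(3,4)] by blast
  \<comment> \<open>The 3 counts the products of a Kronecker delta and a coordinate in front of the
    middle group.\<close>
  define C where "C = cmod (gconst \<nu>) * (C1 + 3 * C2 + C3)"
  have "cmod (pd (\<lambda>y. Gamma_res lam y \<alpha> \<beta> - Gamma_stokes y \<alpha> \<beta>) \<gamma> x) \<le> C * cmod lam * norm x powr (3 - real CARD('n))"
    if h: "lam \<noteq> 0" "x \<noteq> 0" "cmod lam * (norm x)\<^sup>2 \<le> 1" for lam and x :: "real ^ 'n" and \<alpha> \<beta> \<gamma>
  proof -
    define r where "r = norm x"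
    have r: "r > 0" using h by (simp add: r_def)
    define \<rho> where "\<rho> = x \<bullet> x"
    have rho: "\<rho> > 0" "cmod lam * \<rho> \<le> 1" using h by (simp_all add: \<rho>_def power2_norm_eq_inner)
    define B where "B = cmod lam * r powr (- 2 * \<nu>)"
    have B0: "B \<ge> 0" by (simp add: B_def)
    have e1: "cmod lam * \<rho> powr (1 - (\<nu> + 1)) = B"
      using norm_powr_inner[OF h(2), of "- \<nu>"] by (simp add: B_def r_def \<rho>_def)
    have e2: "r ^ 2 * (cmod lam * \<rho> powr (1 - (\<nu> + 2))) = B"
    proof -
      have "\<rho> powr (1 - (\<nu> + 2)) = r powr (- 2 * \<nu> - 2)"
      proof -
        have "1 - (\<nu> + 2) = - \<nu> - 1" "- 2 * \<nu> - 2 = 2 * (- \<nu> - 1)" by simp_all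
        then show ?thesis using norm_powr_inner[OF h(2), of "- \<nu> - 1"] by (simp only: r_def \<rho>_def)
      qed
      also have "\<dots> = r powr (- 2 * \<nu>) / r ^ 2" using r by (simp add: powr_diff)
      finally show ?thesis using r by (simp add: B_def)
    qed
    have e3: "r * B = cmod lam * r powr (3 - real CARD('n))"
    proof -
      have "3 - real CARD('n) = 1 + (- 2 * \<nu>)" using nu by simp
      then have "r powr (3 - real CARD('n)) = r * r powr (- 2 * \<nu>)" using r by (simp only: powr_add) simp
      then show ?thesis by (simp add: B_def)
    qed
    define \<delta> where "\<delta> = (\<lambda>i j :: 'n. if i = j then 1 else 0 :: complex)"
    define X where "X = (\<lambda>i. complex_of_real (x $ i))"
    have X: "cmod (X i) \<le> r" for i unfolding X_def r_def by (simp add: component_le_norm_cart)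
    have dX: "cmod (\<delta> i j * X k) \<le> r" for i j k using X[of k] r by (simp add: \<delta>_def)
    define T1 T2 T3 where "T1 = hdiff (\<nu> + 1) lam \<rho>" and "T2 = hdiff (\<nu> + 2) lam \<rho> / lam + hlead (\<nu> + 1) \<rho> / 2"
      and "T3 = hdiff (\<nu> + 3) lam \<rho> / lam + hlead (\<nu> + 2) \<rho> / 2"
    have t1: "cmod T1 \<le> C1 * B" using b1[OF h(1) rho] e1 by (simp add: T1_def mult.assoc)
    have nn: "\<nu> + 1 + 1 = \<nu> + 2" "\<nu> + 2 + 1 = \<nu> + 3" by simp_all
    have t2: "cmod T2 \<le> C2 * B" using b2[OF h(1) rho] e1 by (simp only: nn T2_def mult.assoc)
    have t3: "cmod T3 \<le> C3 * (cmod lam * \<rho> powr (1 - (\<nu> + 2)))"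
      using b3[OF h(1) rho] by (simp only: nn T3_def mult.assoc)
    have p: "pd (\<lambda>y. Gamma_res lam y \<alpha> \<beta> - Gamma_stokes y \<alpha> \<beta>) \<gamma> x = gconst \<nu> *
      (- (\<delta> \<alpha> \<beta> * X \<gamma> * T1) - (\<delta> \<alpha> \<beta> * X \<gamma> + \<delta> \<gamma> \<alpha> * X \<beta> + \<delta> \<gamma> \<beta> * X \<alpha>) * T2 + X \<alpha> * X \<beta> * X \<gamma> * T3)"
      using grad_entry[OF h(2,1) nu(1)] nu(2) unfolding \<delta>_def X_def T1_def T2_def T3_def \<rho>_def by simp
    have q1: "cmod (\<delta> \<alpha> \<beta> * X \<gamma> * T1) \<le> r * (C1 * B)"
      unfolding norm_mult[of "_ * _" T1] using dX t1 r by (intro mult_mono) auto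
    have "cmod (\<delta> \<alpha> \<beta> * X \<gamma> + \<delta> \<gamma> \<alpha> * X \<beta> + \<delta> \<gamma> \<beta> * X \<alpha>) \<le> 3 * r"
      using norm_triangle_ineq[of "\<delta> \<alpha> \<beta> * X \<gamma> + \<delta> \<gamma> \<alpha> * X \<beta>" "\<delta> \<gamma> \<beta> * X \<alpha>"]
        norm_triangle_ineq[of "\<delta> \<alpha> \<beta> * X \<gamma>" "\<delta> \<gamma> \<alpha> * X \<beta>"] dX[of \<alpha> \<beta> \<gamma>] dX[of \<gamma> \<alpha> \<beta>] dX[of \<gamma> \<beta> \<alpha>] by linarith
    then have q2: "cmod ((\<delta> \<alpha> \<beta> * X \<gamma> + \<delta> \<gamma> \<alpha> * X \<beta> + \<delta> \<gamma> \<beta> * X \<alpha>) * T2) \<le> 3 * r * (C2 * B)"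
      unfolding norm_mult[of _ T2] using t2 r by (intro mult_mono) auto
    have q3: "cmod (X \<alpha> * X \<beta> * X \<gamma> * T3) \<le> r * (C3 * B)"
    proof -
      have "cmod (X \<alpha> * X \<beta> * X \<gamma> * T3) \<le> r * r * r * (C3 * (cmod lam * \<rho> powr (1 - (\<nu> + 2))))"
        unfolding norm_mult by (intro mult_mono X t3) (use r in auto)
      also have "\<dots> = r * (C3 * (r ^ 2 * (cmod lam * \<rho> powr (1 - (\<nu> + 2)))))"
        by (simp only: power2_eq_square mult_ac)
      finally show ?thesis unfolding e2 .
    qed
    have tri: "cmod (- a - b + c) \<le> cmod a + cmod b + cmod c" for a b c
      using norm_triangle_ineq[of "- a - b" c] norm_triangle_ineq4[of "- a" b] by simp
    have "cmod (- (\<delta> \<alpha> \<beta> * X \<gamma> * T1) - (\<delta> \<alpha> \<beta> * X \<gamma> + \<delta> \<gamma> \<alpha> * X \<beta> + \<delta> \<gamma> \<beta> * X \<alpha>) * T2 + X \<alpha> * X \<beta> * X \<gamma> * T3)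
        \<le> r * (C1 * B) + 3 * r * (C2 * B) + r * (C3 * B)"
      by (rule order_trans[OF tri add_mono[OF add_mono[OF q1 q2] q3]])
    also have "\<dots> = (C1 + 3 * C2 + C3) * (r * B)" by (simp add: algebra_simps)
    also note e3
    finally show ?thesis unfolding p norm_mult[of "gconst \<nu>"] C_def mult.assoc r_def
      by (rule mult_left_mono) simp
  qed
  moreover have "C > 0" unfolding C_def using C1 C2 C3 by (intro mult_pos_pos) (auto simp: gconst_def)
  ultimately show ?thesis by blast
qed

section \<open>From single entries to the full norm and the three cases\<close>

lemma grad_diff_norm_le:
  fixes x :: "real ^ 'n::finite"
  assumes "\<And>\<alpha> \<beta> \<gamma>. cmod (pd (\<lambda>y. Gamma_res lam y \<alpha> \<beta> - Gamma_stokes y \<alpha> \<beta>) \<gamma> x) \<le> B"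
  shows "grad_diff_norm lam x \<le> (real CARD('n))\<^sup>2 * B"
proof -
  define N where "N = real CARD('n)"
  have N: "N \<ge> 1" unfolding N_def by (simp add: Suc_leI)
  have B0: "B \<ge> 0" using assms norm_ge_zero order_trans by blast
  have "(\<Sum>\<alpha>\<in>UNIV. \<Sum>\<beta>\<in>UNIV. \<Sum>\<gamma>\<in>UNIV. (cmod (pd (\<lambda>y. Gamma_res lam y \<alpha> \<beta> - Gamma_stokes y \<alpha> \<beta>) \<gamma> x))\<^sup>2)
      \<le> (\<Sum>\<alpha>\<in>(UNIV :: 'n set). \<Sum>\<beta>\<in>(UNIV :: 'n set). \<Sum>\<gamma>\<in>(UNIV :: 'n set). B\<^sup>2)"
    by (intro sum_mono power_mono assms) auto
  also have "\<dots> = N ^ 3 * B\<^sup>2" by (simp add: N_def power3_eq_cube)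
  \<comment> \<open>There are N^3 entries; rounding up to N^4 makes the square root the polynomial
    factor N^2.\<close>
  also have "\<dots> \<le> N ^ 4 * B\<^sup>2" using N by (intro mult_right_mono power_increasing) auto
  also have "\<dots> = (N\<^sup>2 * B)\<^sup>2" by (simp add: power_mult_distrib)
  finally show ?thesis unfolding grad_diff_norm_def N_def[symmetric]
    using N B0 by (intro real_le_lsqrt) auto
qed

theorem theorem2p2:
  fixes \<theta> :: real
  assumes "CARD('n::finite) \<ge> 3" and "0 < \<theta>" and "\<theta> < pi / 2"
  shows "\<exists>C>0. \<forall>lam\<in>Sigma \<theta>. \<forall>x :: real ^ 'n. x \<noteq> 0 \<and> cmod lam * (norm x)\<^sup>2 \<le> 1 / 2 \<longrightarrow>
     grad_diff_norm lam x \<le>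
       (if CARD('n) = 3 then C * sqrt (cmod lam) * (norm x) powr (-1)
        else if CARD('n) = 4 \<or> CARD('n) = 6
          then C * cmod lam * (norm x) powr (3 - real CARD('n)) * \<bar>ln (cmod lam * (norm x)\<^sup>2)\<bar>
        else C * cmod lam * (norm x) powr (3 - real CARD('n)))"
proof -
  define \<nu> where "\<nu> = real CARD('n) / 2 - 1"
  have nu: "\<nu> \<ge> 1 / 2" using assms(1) by (simp add: \<nu>_def)
  obtain K where K: "K > 0" "\<And>lam (x :: real ^ 'n) \<alpha> \<beta> \<gamma>. lam \<noteq> 0 \<Longrightarrow> x \<noteq> 0 \<Longrightarrow> cmod lam * (norm x)\<^sup>2 \<le> 1 \<Longrightarrow>
    cmod (pd (\<lambda>y. Gamma_res lam y \<alpha> \<beta> - Gamma_stokes y \<alpha> \<beta>) \<gamma> x) \<le> K * cmod lam * norm x powr (3 - real CARD('n))"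
    using grad_entry_bound[OF \<nu>_def nu] by blast
  \<comment> \<open>The factor 2 is reserved for d = 4 and d = 6, where |ln t| may be as small as ln
    2 and is only bounded below by 1/2.\<close>
  define C where "C = 2 * ((real CARD('n))\<^sup>2 * K)"
  have C: "C > 0" using K(1) by (simp add: C_def)
  have "grad_diff_norm lam x \<le>
       (if CARD('n) = 3 then C * sqrt (cmod lam) * (norm x) powr (-1)
        else if CARD('n) = 4 \<or> CARD('n) = 6
          then C * cmod lam * (norm x) powr (3 - real CARD('n)) * \<bar>ln (cmod lam * (norm x)\<^sup>2)\<bar>
        else C * cmod lam * (norm x) powr (3 - real CARD('n)))"
    if h: "lam \<in> Sigma \<theta>" "x \<noteq> 0" "cmod lam * (norm x)\<^sup>2 \<le> 1 / 2" for lam and x :: "real ^ 'n"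
  proof -
    have lam: "lam \<noteq> 0" using h(1) by (simp add: Sigma_def)
    define t where "t = cmod lam * (norm x)\<^sup>2"
    have t: "0 < t" "t \<le> 1 / 2" using h lam by (simp_all add: t_def)
    define P where "P = C * cmod lam * norm x powr (3 - real CARD('n))"
    have P0: "P \<ge> 0" using C by (simp add: P_def)
    have le: "cmod lam * (norm x)\<^sup>2 \<le> 1" using h(3) by simp
    have "grad_diff_norm lam x \<le> (real CARD('n))\<^sup>2 * (K * cmod lam * norm x powr (3 - real CARD('n)))"
      by (rule grad_diff_norm_le[OF K(2)[OF lam h(2) le]])
    then have g: "grad_diff_norm lam x \<le> P / 2" by (simp add: P_def C_def mult.assoc)
    \<comment> \<open>For d = 3 the bound is C |\<open>lam\<close>|; one factor
      sqrt|\<open>lam\<close>| is traded for 1/|x|, since |\<open>lam\<close>| |x|^2 \<le>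
      1.\<close>
    have three: "P \<le> C * sqrt (cmod lam) * norm x powr (-1)" if "CARD('n) = 3"
    proof -
      have "sqrt t \<le> 1" using t by simp
      moreover have "sqrt t = sqrt (cmod lam) * norm x" by (simp add: t_def real_sqrt_mult)
      ultimately have "sqrt (cmod lam) * norm x \<le> 1" by simp
      then have "sqrt (cmod lam) \<le> norm x powr (-1)" using h(2) by (simp add: powr_minus_divide field_simps)
      then have "C * sqrt (cmod lam) * sqrt (cmod lam) \<le> C * sqrt (cmod lam) * norm x powr (-1)"
        using C by (intro mult_left_mono) auto
      then show ?thesis using that h(2) by (simp add: P_def mult.assoc)
    qed
    have four: "P / 2 \<le> P * \<bar>ln t\<bar>"
    proof -
      have "ln t \<le> t - 1" using t by (intro ln_le_minus_one)
      then have "1 / 2 \<le> \<bar>ln t\<bar>" using t by linarith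
      from mult_left_mono[OF this P0] show ?thesis by simp
    qed
    show ?thesis
    proof (cases "CARD('n) = 3")
      case True
      then show ?thesis using g three P0 by simp
    next
      case False
      then show ?thesis using g four P0 by (simp add: P_def t_def)
    qed
  qed
  with C show ?thesis by blast
qed

end
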